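(* Let $J$ be a finite subset of $\mathbb{N}$ and $\{\zeta_i\}_{i\in J}$ independent $\mathbb{Z}_+$-valued random variables with $\mathbb{E}(\zeta_i^3)<\infty$; let $V=\sum_{i\in J}\zeta_i$, $\gamma_{i,k}=\mathbb{P}(\zeta_i=k)$, $\delta_j=\min\{\tfrac12,1-d_{TV}(\zeta_j,\zeta_j+1)\}$ and $\delta^*=\max_{j\in J}\delta_j$. Let $r>1$, $p\in(0,1)$, $q=1-p$. Define $U_J^*$ as follows. Case (a): if $rq/p=\mathbb{E}(V)$, $$U_J^*=\sum_{i\in J}\sum_{k=1}^{\infty}k\,\big|(p\,\mathbb{E}(\zeta_i)+qk)\gamma_{i,k}-(k+1)\gamma_{i,k+1}\big|.$$ Case (b): if $rq/p=\mathbb{E}(V)$ and $rq/p^2=\mathrm{Var}(V)$, $$U_J^*=\sqrt{\tfrac{2}{\pi}}\Big(\tfrac14+\sum_{j\in J}\delta_j-\delta^*\Big)^{-1/2}\Big\{\sum_{i\in J}\mathbb{E}(\zeta_i)\big|p(\mathbb{E}\zeta_i)^2+q\,\mathbb{E}(\zeta_i^2)-\mathbb{E}(\zeta_i(\zeta_i-1))\big|+\sum_{i\in J}\sum_{k=2}^{\infty}\tfrac{k(k-1)}{2}\big|(p\,\mathbb{E}(\zeta_i)+qk)\gamma_{i,k}-(k+1)\gamma_{i,k+1}\big|\Big\}.$$ Then, in each case, (1) $\sup_{z\ge0}|\mathbb{E}[\mathscr{A}g_z(V)]|\le\left(2p^{-(r+1)}-p^{-1}\right)U_J^*$; (2) $|\mathbb{E}[\mathscr{A}g_z(V)]|\le\vartheta_{r,p,z}\,U_J^*$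 for all $z>1$, where $\vartheta_{r,p,z}=\frac{r+1}{z}\left((1+q^{-1})p^{-(r+2)}-p^{-2}\right)$.
   Context: $\mathbb{Z}_+=\{0,1,2,\ldots\}$, $x^+=\max\{x,0\}$, $d_{TV}$ is total variation distance. $\mathrm{N}_{r,p}$ is negative binomial with $\mathbb{P}(\mathrm{N}_{r,p}=k)=\binom{r+k-1}{k}p^rq^k$, $k\in\mathbb{Z}_+$ (mean $rq/p$, variance $rq/p^2$). The Stein operator is $\mathscr{A}g(k)=q(r+k)g(k+1)-kg(k)$. For $z\ge0$, $g_z(0)=0$ and for $k\ge1$, $g_z(k)=-\sum_{j\ge k}\frac{r(r+1)\cdots(r+j-1)}{r(r+1)\cdots(r+k-1)}\frac{(k-1)!}{j!}q^{j-k}\big[(j-z)^+-\mathbb{E}[(\mathrm{N}_{r,p}-z)^+]\big]$, so that $\mathbb{E}[\mathscr{A}g_z(V)]=\mathbb{E}[(V-z)^+]-\mathbb{E}[(\mathrm{N}_{r,p}-z)^+]$. *)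

theory Defs
  imports "HOL-Probability.Probability"
begin

text \<open>Negative binomial pmf NB(r,p): binom(r+k-1,k) p^r q^k, q = 1 - p.\<close>
definition nb_pmf :: "real \<Rightarrow> real \<Rightarrow> nat \<Rightarrow> real" where
  "nb_pmf r p k = pochhammer r k / fact k * p powr r * (1 - p) ^ k"

definition nb_excess :: "real \<Rightarrow> real \<Rightarrow> real \<Rightarrow> real" where
  "nb_excess r p z = (\<Sum>k. nb_pmf r p k * max (real k - z) 0)"

text \<open>The Stein solution g_z; the sum over j \<ge> k is indexed by j = k + n.\<close>
definition stein_g :: "real \<Rightarrow> real \<Rightarrow> real \<Rightarrow> nat \<Rightarrow> real" where
  "stein_g r p z k = (if k = 0 then 0 else
     - (\<Sum>n. pochhammer r (k + n) / pochhammer r k * (fact (k - 1) / fact (k + n))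
            * (1 - p) ^ n * (max (real (k + n) - z) 0 - nb_excess r p z)))"

definition stein_op :: "real \<Rightarrow> real \<Rightarrow> (nat \<Rightarrow> real) \<Rightarrow> nat \<Rightarrow> real" where
  "stein_op r p g k = (1 - p) * (r + real k) * g (Suc k) - real k * g k"

definition pt_prob :: "'a measure \<Rightarrow> ('a \<Rightarrow> nat) \<Rightarrow> nat \<Rightarrow> real" where
  "pt_prob M X k = measure M {x \<in> space M. X x = k}"

definition dtv_nat :: "(nat \<Rightarrow> real) \<Rightarrow> (nat \<Rightarrow> real) \<Rightarrow> real" where
  "dtv_nat f g = (1 / 2) * (\<Sum>k. \<bar>f k - g k\<bar>)"

end

theory Submission
  imports Defs
begin

text \<open>
  Write \<open>N\<close> for the negative binomial variable, \<open>w\<close> for its weights and \<open>\<alpha> k = q (r + k)\<close>.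
  Detailed balance \<open>(k + 1) w (k + 1) = \<alpha> k w k\<close> gives, for \<open>k \<ge> 1\<close>,
  \<open>g k - g (k + 1) = p E (N - z)\<^sup>+ E (k - N)\<^sup>+ / (k \<alpha> k w k)\<close> if \<open>k \<le> z\<close> and
  \<open>g k - g (k + 1) = p E (z - N)\<^sup>+ E (N - k)\<^sup>+ / (k \<alpha> k w k)\<close> if \<open>k \<ge> z\<close>.
  So \<open>g\<close> is decreasing, and a termwise comparison with a negative binomial series of parameter
  \<open>r + 2\<close> bounds its steps by \<open>p powr - (r + 1) / max 1 z\<close>.

  The expectation of the Stein operator is \<open>\<Sum>i \<Sum>k a i k E g (V i + k + 1)\<close> with
  \<open>V i = V - \<zeta> i\<close> and \<open>a i k = (p E \<zeta> i + q k) \<gamma> i k - (k + 1) \<gamma> i (k + 1)\<close>. As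
  \<open>\<Sum>k a i k = 0\<close>, a first-order expansion in \<open>k\<close> gives (a). In case (b)
  the first-order terms \<open>\<Sum>k k a i k\<close> sum to zero over \<open>i\<close>, and a second-order expansion leaves
  \<open>E \<Delta>f (V i)\<close> for \<open>f\<close> the steps of \<open>g\<close>. As these all lie in \<open>[0, C]\<close>, no factor 2 is lost in
  passing to the total variation distance of \<open>V i\<close> and \<open>V i + 1\<close>. That distance is estimated by extracting fair
  coin flips from the summands: \<open>K\<close> flips contribute
  \<open>(K choose K div 2) / 2 ^ K = (1 / \<pi>) \<integral> (1 + cos t) cos t ^ K dt\<close> over \<open>[0, \<pi>]\<close>, averaging over
  the number of flips gives \<open>(1 / \<pi>) \<integral> (1 + cos t) \<Prod>j (1 - \<delta> j + \<delta> j cos t) dt\<close>, and the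
  substitution \<open>x = sin (t / 2)\<close> bounds this by a Gaussian integral. The cap \<open>\<delta> j \<le> 1 / 2\<close> keeps
  the factors nonnegative.
\<close>

section \<open>The Stein solution for the negative binomial law\<close>

lemma pochhammer_power_sums:
  fixes a x :: real
  assumes "\<bar>x\<bar> < 1"
  shows "(\<lambda>n. pochhammer a n / fact n * x ^ n) sums (1 - x) powr (- a)"
proof -
  have "(\<lambda>n. (- a gchoose n) * (- x) ^ n) sums (1 + (- x)) powr (- a)"
    using assms by (intro gen_binomial_real) simp
  moreover have "(- a gchoose n) * (- x) ^ n = pochhammer a n / fact n * x ^ n" for n
  proof -
    have "(- x) ^ n = (- 1) ^ n * x ^ n" by (metis power_minus)
    then show ?thesis by (simp add: gbinomial_pochhammer)
  qed
  ultimately show ?thesis by simp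
qed

section \<open>Negative binomial weights and their tail sums\<close>

locale neg_binomial =
  fixes r p q :: real
  assumes r_gt_1: "r > 1" and p_pos: "0 < p" and p_less_1: "p < 1" and q_eq: "q = 1 - p"
begin

abbreviation w :: "nat \<Rightarrow> real" where "w \<equiv> nb_pmf r p"

lemma q_pos: "0 < q" and q_less_1: "q < 1"
  using p_pos p_less_1 q_eq by auto

lemma w_pos: "w k > 0"
  using r_gt_1 p_pos p_less_1 by (auto simp: nb_pmf_def intro!: mult_pos_pos divide_pos_pos pochhammer_pos)

lemma w_nonneg: "w k \<ge> 0"
  using w_pos[of k] by simp

lemma w_Suc: "real (Suc k) * w (Suc k) = q * (r + real k) * w k"
proof -
  have "fact (Suc k) = real (Suc k) * fact k" by simp
  then show ?thesis
    by (simp add: nb_pmf_def q_eq pochhammer_Suc divide_simps del: fact_Suc of_nat_Suc)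
qed

lemma w_sums: "w sums 1"
proof -
  have "(\<lambda>n. p powr r * (pochhammer r n / fact n * q ^ n)) sums (p powr r * (1 - q) powr (- r))"
    using q_pos q_less_1 by (intro sums_mult pochhammer_power_sums) auto
  moreover have "p powr r * (1 - q) powr (- r) = 1"
    using p_pos q_eq by (simp add: powr_minus)
  ultimately show ?thesis by (simp add: nb_pmf_def[abs_def] q_eq mult_ac)
qed

text \<open>After a shift by one, detailed balance turns the terms into a constant times the
  binomial series with parameter \<open>r + 1\<close>.\<close>

lemma mean_sums: "(\<lambda>k. real k * w k) sums (r * q / p)"
proof -
  have "(\<lambda>n. p powr r * (q * r) * (pochhammer (r + 1) n / fact n * q ^ n))
          sums (p powr r * (q * r) * (1 - q) powr (- (r + 1)))"
    using q_pos q_less_1 by (intro sums_mult pochhammer_power_sums) auto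
  moreover have "p powr r * (q * r) * (1 - q) powr (- (r + 1)) = r * q / p"
    using p_pos q_eq by (simp add: powr_diff powr_add powr_minus divide_simps)
  moreover have "real (Suc n) * w (Suc n) = p powr r * (q * r) * (pochhammer (r + 1) n / fact n * q ^ n)" for n
  proof -
    have "pochhammer (r + 1) n * r = (r + real n) * pochhammer r n"
      using pochhammer_rec[of r n] pochhammer_Suc[of r n] by (simp add: mult_ac)
    then have "p powr r * q * q ^ n / fact n * (pochhammer (r + 1) n * r)
        = p powr r * q * q ^ n / fact n * ((r + real n) * pochhammer r n)"
      by simp
    then show ?thesis
      unfolding w_Suc by (auto simp: nb_pmf_def q_eq[symmetric] mult_ac)
  qed
  ultimately have "(\<lambda>n. real (Suc n) * w (Suc n)) sums (r * q / p)" by simp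
  then show ?thesis by (subst (asm) sums_Suc_iff) simp
qed

lemma w_summable_shift: "summable (\<lambda>n. w (k + n))"
  using summable_iff_shift[of w k] sums_summable[OF w_sums] by (simp add: add.commute)

lemma mean_summable_shift: "summable (\<lambda>n. real (k + n) * w (k + n))"
  using summable_iff_shift[of "\<lambda>k. real k * w k" k] sums_summable[OF mean_sums] by (simp add: add.commute)

lemma tail_Suc:
  fixes f :: "nat \<Rightarrow> real"
  assumes "summable (\<lambda>n. f (k + n))"
  shows "(\<Sum>n. f (Suc k + n)) = (\<Sum>n. f (k + n)) - f k"
  using suminf_split_head[OF assms] by simp

lemma tail_split:
  fixes f :: "nat \<Rightarrow> real"
  assumes "f sums s"
  shows "(\<Sum>n. f (k + n)) = s - (\<Sum>j<k. f j)"
  using suminf_split_initial_segment[of f k] assms by (simp add: add.commute sums_iff)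

definition tail_mass :: "nat \<Rightarrow> real" where "tail_mass k = (\<Sum>n. w (k + n))"
definition tail_mean :: "nat \<Rightarrow> real" where "tail_mean k = (\<Sum>n. real (k + n) * w (k + n))"

text \<open>Two expressions for \<open>tail_mean (Suc k)\<close> are equated: dropping the first
  term of \<open>tail_mean k\<close>, and summing detailed balance over the tail. With
  \<open>1 - q = p\<close> the result later trades \<open>k w k\<close> for tail sums.\<close>

lemma tail_mean_eq: "p * tail_mean k = real k * w k + q * r * tail_mass k"
proof -
  have "tail_mean (Suc k) = tail_mean k - real k * w k"
    unfolding tail_mean_def by (rule tail_Suc[OF mean_summable_shift])
  moreover have "tail_mean (Suc k) = q * r * tail_mass k + q * tail_mean k"
  proof -
    have "real (Suc k + n) * w (Suc k + n) = q * r * w (k + n) + q * (real (k + n) * w (k + n))" for n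
      using w_Suc[of "k + n"] by (simp add: algebra_simps)
    then have "tail_mean (Suc k) = (\<Sum>n. q * r * w (k + n) + q * (real (k + n) * w (k + n)))"
      unfolding tail_mean_def by (intro suminf_cong) auto
    also have "\<dots> = q * r * tail_mass k + q * tail_mean k"
      unfolding tail_mass_def tail_mean_def using w_summable_shift mean_summable_shift
      by (subst suminf_add[symmetric]) (auto intro!: summable_mult simp: suminf_mult)
    finally show ?thesis .
  qed
  ultimately show ?thesis by (simp add: q_eq algebra_simps)
qed

text \<open>Induction on \<open>n\<close> comparing ratios of successive terms. The two sides agree
  at \<open>n = 0\<close>, and the ratio on the left never exceeds
  \<open>q (r + 2 + n) / (n + 1)\<close>, the ratio of the series with parameter
  \<open>r + 2\<close>.\<close>

lemma tail_moment_le: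
  assumes "k \<ge> 1"
  shows "real (n + 1) * real (Suc k + n) * w (Suc k + n)
           \<le> real (Suc k) * w (Suc k) * (pochhammer (r + 2) n / fact n * q ^ n)"
proof (induction n)
  case 0
  show ?case by simp
next
  case (Suc n)
  let ?m = "Suc k + n"
  \<comment> \<open>After expansion this only asks for \<open>(n + 2) r \<le> (k + 1 + n) r\<close>,
    which is where \<open>k \<ge> 1\<close> enters.\<close>
  have step: "real (Suc n + 1) * (r + real ?m) * real (n + 1) \<le> real (n + 1) * real ?m * (r + 2 + real n)"
  proof -
    have "(real n + 2) * (r + real ?m) \<le> real ?m * (r + 2 + real n)"
    proof -
      have "0 \<le> r * (real k - 1)" using assms r_gt_1 by simp
      then show ?thesis by (simp add: algebra_simps)
    qed
    then have "real (n + 1) * ((real n + 2) * (r + real ?m)) \<le> real (n + 1) * (real ?m * (r + 2 + real n))"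
      by (intro mult_left_mono) auto
    then show ?thesis by (simp add: mult_ac add_ac)
  qed
  have "real (Suc n + 1) * real (Suc k + Suc n) * w (Suc k + Suc n)
      = real (Suc n + 1) * (q * (r + real ?m) * w ?m)"
    using w_Suc[of ?m] by (metis add_Suc_right mult.assoc)
  also have "\<dots> = q * w ?m / real (n + 1) * (real (Suc n + 1) * (r + real ?m) * real (n + 1))"
    by (simp add: field_simps)
  also have "\<dots> \<le> q * w ?m / real (n + 1) * (real (n + 1) * real ?m * (r + 2 + real n))"
    using step q_pos w_nonneg by (intro mult_left_mono) auto
  also have "\<dots> = (real (n + 1) * real ?m * w ?m) * (q * (r + 2 + real n) / real (n + 1))"
    by (simp add: field_simps)
  also have "\<dots> \<le> (real (Suc k) * w (Suc k) * (pochhammer (r + 2) n / fact n * q ^ n)) * (q * (r + 2 + real n) / real (n + 1))"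
    using q_pos r_gt_1 by (intro mult_right_mono[OF Suc]) auto
  also have "\<dots> = real (Suc k) * w (Suc k) * (pochhammer (r + 2) (Suc n) / fact (Suc n) * q ^ Suc n)"
  proof -
    have "fact (Suc n) = real (n + 1) * fact n" by simp
    then show ?thesis by (simp add: pochhammer_Suc divide_simps del: fact_Suc of_nat_Suc of_nat_add)
  qed
  finally show ?case .
qed

lemma tail_majorant_sums:
  "(\<lambda>n. c * (pochhammer (r + 2) n / fact n * q ^ n)) sums (c * p powr (- (r + 2)))"
  using sums_mult[OF pochhammer_power_sums[of q "r + 2"], of c] q_pos q_less_1 by (simp add: q_eq)

text \<open>With \<open>m = k + 1 + n\<close> the terms are \<open>(m - k) m w m\<close>, so this is
  \<open>E N (N - k)\<^sup>+\<close>. It is a common majorant: both \<open>E (N - z)\<^sup>+\<close>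
  for \<open>k \<le> z\<close> and \<open>E (N - k)\<^sup>+\<close> for \<open>z < k\<close> stay
  below it after multiplication by \<open>max 1 z\<close>.\<close>

definition tail_moment :: "nat \<Rightarrow> real" where "tail_moment k = (\<Sum>n. real (n + 1) * real (Suc k + n) * w (Suc k + n))"

lemma tail_moment_summable:
  assumes "k \<ge> 1"
  shows "summable (\<lambda>n. real (n + 1) * real (Suc k + n) * w (Suc k + n))"
  by (rule summable_comparison_test'[OF sums_summable[OF tail_majorant_sums[of "real (Suc k) * w (Suc k)"]], of 0])
     (use tail_moment_le[OF assms] w_nonneg in \<open>auto simp: abs_mult simp del: of_nat_Suc of_nat_add\<close>)

lemma tail_moment_bound:
  assumes "k \<ge> 1"
  shows "tail_moment k \<le> real (Suc k) * w (Suc k) * p powr (- (r + 2))"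
proof -
  have "tail_moment k \<le> (\<Sum>n. real (Suc k) * w (Suc k) * (pochhammer (r + 2) n / fact n * q ^ n))"
    unfolding tail_moment_def
    by (intro suminf_le tail_moment_le tail_moment_summable assms sums_summable[OF tail_majorant_sums])
  then show ?thesis
    using sums_unique[OF tail_majorant_sums[of "real (Suc k) * w (Suc k)"]] by simp
qed


text \<open>Both sides are \<open>E (N - k)\<^sup>+\<close>; the atom at \<open>k\<close>
  contributes nothing, so the sum may start at \<open>Suc k\<close>.\<close>

lemma tail_first_moment:
  "(\<Sum>n. real (n + 1) * w (Suc k + n)) = tail_mean k - real k * tail_mass k"
  "summable (\<lambda>n. real (n + 1) * w (Suc k + n))"
proof -
  have eq: "real n * w (k + n) = real (k + n) * w (k + n) - real k * w (k + n)" for n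
    by (simp add: algebra_simps)
  have "(\<lambda>n. real n * w (k + n)) sums (tail_mean k - real k * tail_mass k)"
    unfolding eq tail_mass_def tail_mean_def
    by (intro sums_diff sums_mult summable_sums mean_summable_shift w_summable_shift)
  then have "(\<lambda>n. real (Suc n) * w (k + Suc n)) sums (tail_mean k - real k * tail_mass k)"
    by (subst sums_Suc_iff) simp
  then show "(\<Sum>n. real (n + 1) * w (Suc k + n)) = tail_mean k - real k * tail_mass k"
    "summable (\<lambda>n. real (n + 1) * w (Suc k + n))"
    by (auto simp: sums_iff)
qed

text \<open>Every atom in the sum for \<open>E (N - k)\<^sup>+\<close> lies at \<open>k + 1\<close>
  or beyond, so the factor \<open>c\<close> is at most the atom itself.\<close>

lemma tail_first_moment_le:
  assumes "k \<ge> 1" "c \<le> real (k + 1)" "c \<ge> 0"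
  shows "c * (tail_mean k - real k * tail_mass k) \<le> tail_moment k"
proof -
  have "c * (real (n + 1) * w (Suc k + n)) \<le> real (n + 1) * real (Suc k + n) * w (Suc k + n)" for n
  proof -
    have "c * (real (n + 1) * w (Suc k + n)) \<le> real (Suc k + n) * (real (n + 1) * w (Suc k + n))"
      using assms w_nonneg by (intro mult_right_mono) auto
    then show ?thesis by (simp only: mult_ac)
  qed
  then have "(\<Sum>n. c * (real (n + 1) * w (Suc k + n))) \<le> tail_moment k"
    unfolding tail_moment_def by (intro suminf_le tail_moment_summable assms summable_mult tail_first_moment) auto
  then show ?thesis
    by (simp only: suminf_mult[OF tail_first_moment(2)] tail_first_moment(1))
qed

section \<open>The Stein solution and bounds on its steps\<close>

context
  fixes z :: real
  assumes z_nonneg: "z \<ge> 0"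
begin

abbreviation h :: "nat \<Rightarrow> real" where "h j \<equiv> max (real j - z) 0"

abbreviation e :: real where "e \<equiv> nb_excess r p z"

lemma excess_summable: "summable (\<lambda>j. w j * h j)"
proof (rule summable_comparison_test'[OF sums_summable[OF mean_sums], of 0])
  fix n
  have "w n * h n \<le> w n * real n"
    using z_nonneg by (intro mult_left_mono w_nonneg) auto
  then show "norm (w n * h n) \<le> real n * w n"
    using w_nonneg[of n] by (simp add: mult.commute)
qed

lemma excess_sums: "(\<lambda>j. w j * h j) sums e"
  unfolding nb_excess_def by (rule summable_sums[OF excess_summable])

lemma excess_nonneg: "e \<ge> 0"
  using sums_le[OF _ sums_zero excess_sums] w_nonneg by force

text \<open>Taking expectations in \<open>z + (N - z)\<^sup>+ - N = (z - N)\<^sup>+\<close>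
  identifies the quantity as \<open>E (z - N)\<^sup>+\<close>, whose integrand lies between 0 and
  \<open>z\<close>.\<close>

lemma shortfall_bounds: "0 \<le> z + e - r * q / p" "z + e - r * q / p \<le> z"
proof -
  have eq: "z * w j + w j * h j - real j * w j = w j * max (z - real j) 0" for j
    by (auto simp: max_def algebra_simps)
  have "(\<lambda>j. z * w j + w j * h j - real j * w j) sums (z * 1 + e - r * q / p)"
    by (intro sums_diff sums_add sums_mult w_sums mean_sums excess_sums)
  then have s: "(\<lambda>j. w j * max (z - real j) 0) sums (z + e - r * q / p)"
    unfolding eq by simp
  show "0 \<le> z + e - r * q / p"
    by (rule sums_le[OF _ sums_zero s]) (simp add: w_nonneg)
  have "(\<lambda>j. w j * z) sums (1 * z)" by (intro sums_mult2 w_sums)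
  then show "z + e - r * q / p \<le> z"
    using sums_le[OF _ s, of "\<lambda>j. w j * z" "1 * z"] w_nonneg z_nonneg by (simp add: mult_left_mono)
qed

text \<open>Atoms up to \<open>k\<close> do not contribute because \<open>k \<le> z\<close>. At a
  contributing atom \<open>j > z\<close> one has \<open>max 1 z \<le> j\<close> and
  \<open>j - z \<le> j - k\<close>, which gives the term of \<open>tail_moment\<close>.\<close>

lemma excess_le:
  assumes "k \<ge> 1" "real k \<le> z" "c \<le> max 1 z" "c \<ge> 0"
  shows "c * e \<le> tail_moment k"
proof -
  have "(\<Sum>j<Suc k. w j * h j) = 0"
    using assms by (intro sum.neutral) auto
  then have e: "e = (\<Sum>n. w (Suc k + n) * h (Suc k + n))"
    using tail_split[OF excess_sums, of "Suc k"] by linarith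
  have "c * (w (Suc k + n) * h (Suc k + n)) \<le> real (n + 1) * real (Suc k + n) * w (Suc k + n)" for n
  proof -
    have "c * h (Suc k + n) \<le> real (Suc k + n) * real (n + 1)"
    proof (cases "real (Suc k + n) \<le> z")
      case False
      then show ?thesis using assms z_nonneg by (intro mult_mono) auto
    qed auto
    then have "c * h (Suc k + n) * w (Suc k + n) \<le> real (Suc k + n) * real (n + 1) * w (Suc k + n)"
      by (intro mult_right_mono w_nonneg)
    then show ?thesis by (simp only: mult_ac)
  qed
  moreover have sm: "summable (\<lambda>n. w (Suc k + n) * h (Suc k + n))"
    using summable_iff_shift[of "\<lambda>j. w j * h j" "Suc k"] excess_summable by (simp add: add.commute)
  ultimately have "(\<Sum>n. c * (w (Suc k + n) * h (Suc k + n))) \<le> tail_moment k"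
    unfolding tail_moment_def by (intro suminf_le tail_moment_summable assms summable_mult) auto
  then show ?thesis unfolding e using suminf_mult[OF sm] by simp
qed

definition centred_tail :: "nat \<Rightarrow> real" where "centred_tail k = (\<Sum>n. w (k + n) * (h (k + n) - e))"

lemma centred_sums: "(\<lambda>j. w j * (h j - e)) sums 0"
proof -
  have "(\<lambda>j. w j * h j - w j * e) sums (e - 1 * e)"
    by (intro sums_diff sums_mult2 w_sums excess_sums)
  then show ?thesis by (simp add: algebra_simps)
qed

text \<open>The coefficient of the \<open>n\<close>-th term of the defining series is
  \<open>w (k + n) / (k w k)\<close>: the power \<open>p powr r\<close> cancels and
  \<open>fact k = k * fact (k - 1)\<close>.\<close>

lemma stein_g_eq:
  assumes "k \<ge> 1"
  shows "stein_g r p z k = - centred_tail k / (real k * w k)"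
proof -
  have sm: "summable (\<lambda>n. w (k + n) * (h (k + n) - e))"
    using summable_iff_shift[of "\<lambda>j. w j * (h j - e)" k] sums_summable[OF centred_sums]
    by (simp add: add.commute)
  have "pochhammer r (k + n) / pochhammer r k * (fact (k - 1) / fact (k + n)) * (1 - p) ^ n * x
      = w (k + n) * x / (real k * w k)" for n x
  proof -
    have "pochhammer r k > 0" "p powr r > 0" "(fact k :: real) = real k * fact (k - 1)" "q ^ k > 0"
      using r_gt_1 p_pos q_pos assms by (auto intro: pochhammer_pos simp: fact_reduce)
    then show ?thesis
      using assms p_pos q_pos by (simp add: nb_pmf_def q_eq[symmetric] power_add field_simps)
  qed
  then have "stein_g r p z k = - (\<Sum>n. w (k + n) * (h (k + n) - e) / (real k * w k))"
    using assms by (simp add: stein_g_def)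
  also have "\<dots> = - centred_tail k / (real k * w k)"
    unfolding centred_tail_def by (subst suminf_divide[OF sm]) simp
  finally show ?thesis .
qed

lemma stein_g_Suc: "stein_g r p z (Suc k) = - centred_tail (Suc k) / (real (Suc k) * w (Suc k))"
  by (rule stein_g_eq) simp

text \<open>Detailed balance rewrites \<open>k w k\<close> so that both values share the denominator
  \<open>k (k + 1) w (k + 1)\<close>. The sign question is thereby reduced to the numerator.\<close>

lemma stein_g_diff:
  assumes "k \<ge> 1"
  shows "stein_g r p z k - stein_g r p z (Suc k)
    = (real k * centred_tail (Suc k) - q * (r + real k) * centred_tail k) / (real k * (real (Suc k) * w (Suc k)))"
proof -
  have "q * (r + real k) * w k > 0" using q_pos r_gt_1 w_pos by (intro mult_pos_pos) auto
  then show ?thesis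
    unfolding stein_g_eq[OF assms] stein_g_Suc w_Suc
    using assms w_pos[of k] q_pos r_gt_1 by (simp add: divide_simps)
qed

text \<open>In either case the numerator is \<open>p\<close> times a product of two nonnegative
  expectations. One is at most \<open>k\<close>, which cancels in the denominator; the other,
  multiplied by \<open>max 1 z\<close>, is at most \<open>tail_moment k\<close>. The factor
  \<open>max 1 z\<close> covers the bound uniform in \<open>z\<close> and the decay in
  \<open>1 / z\<close> at once.\<close>

lemma stein_g_diff_bounds:
  assumes "k \<ge> 1"
  shows "0 \<le> stein_g r p z k - stein_g r p z (Suc k)" (is ?lower)
    and "max 1 z * (stein_g r p z k - stein_g r p z (Suc k)) \<le> p powr (- (r + 1))" (is ?upper)
proof -
  have centred_tail_Suc: "centred_tail (Suc k) = centred_tail k - w k * (h k - e)"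
    unfolding centred_tail_def
    using summable_iff_shift[of "\<lambda>j. w j * (h j - e)" k] sums_summable[OF centred_sums]
    by (intro tail_Suc) (simp add: add.commute)
  let ?N = "real k * centred_tail (Suc k) - q * (r + real k) * centred_tail k"
  have "0 \<le> ?N \<and> max 1 z * ?N \<le> p * real k * tail_moment k"
  proof (cases "real k \<le> z")
    case True
    \<comment> \<open>Below \<open>k \<le> z\<close> the positive part vanishes. As the full centred
      sum is 0, the tail from \<open>k\<close> is \<open>e\<close> times the mass below
      \<open>k\<close>.\<close>
    have "w j * (h j - e) = - e * w j" if "j < k" for j
      using that True by (auto simp: max_def)
    then have "centred_tail k = e * (\<Sum>j<k. w j)"
      unfolding centred_tail_def tail_split[OF centred_sums] by (simp add: sum_distrib_left sum_negf)
    moreover have tail_mass: "tail_mass k = 1 - (\<Sum>j<k. w j)" unfolding tail_mass_def by (rule tail_split[OF w_sums])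
    ultimately have Rk: "centred_tail k = e * (1 - tail_mass k)" by simp
    have tail_mean: "tail_mean k = r * q / p - (\<Sum>j<k. real j * w j)" unfolding tail_mean_def by (rule tail_split[OF mean_sums])
    \<comment> \<open>\<open>S\<close> is \<open>E (k - N)\<^sup>+\<close>, the second factor of the
      numerator besides \<open>e\<close>.\<close>
    define S where "S = (\<Sum>j<k. (real k - real j) * w j)"
    have S: "S = real k * (1 - tail_mass k) - (r * q / p - tail_mean k)"
      unfolding S_def tail_mass tail_mean by (simp add: algebra_simps sum_subtractf sum_distrib_left)
    \<comment> \<open>\<open>tail_mean_eq\<close> removes \<open>tail_mean k\<close> together with
      the mean \<open>r q / p\<close>, leaving exactly the coefficient of \<open>e\<close> in the
      numerator.\<close>
    have "p * S = p * real k * (1 - tail_mass k) - r * q + p * tail_mean k"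
      unfolding S using p_pos by (simp add: algebra_simps)
    also have "\<dots> = (real k - q * (r + real k)) * (1 - tail_mass k) + real k * w k"
      unfolding tail_mean_eq q_eq by (simp add: algebra_simps)
    finally have pS: "p * S = (real k - q * (r + real k)) * (1 - tail_mass k) + real k * w k" .
    have "h k = 0" using True by simp
    then have N: "?N = p * S * e"
      unfolding centred_tail_Suc Rk pS by (simp add: algebra_simps)
    have S0: "0 \<le> S" unfolding S_def by (intro sum_nonneg mult_nonneg_nonneg w_nonneg) auto
    have "S \<le> (\<Sum>j<k. real k * w j)"
      unfolding S_def by (intro sum_mono mult_right_mono w_nonneg) auto
    also have "\<dots> \<le> real k * 1"
      unfolding sum_distrib_left[symmetric]
      using sum_le_suminf[OF sums_summable[OF w_sums], of "{..<k}"] w_nonneg sums_unique[OF w_sums]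
      by (intro mult_left_mono) auto
    finally have Sk: "S \<le> real k" by simp
    have "max 1 z * ?N = p * (S * (max 1 z * e))" unfolding N by simp
    also have "\<dots> \<le> p * (real k * tail_moment k)"
      using S0 Sk p_pos excess_nonneg True assms
      by (intro mult_left_mono mult_mono excess_le mult_nonneg_nonneg) auto
    finally show ?thesis using N S0 p_pos excess_nonneg by (simp add: mult.assoc)
  next
    case False
    \<comment> \<open>\<open>D\<close> is \<open>E (z - N)\<^sup>+\<close> and \<open>T\<close> is
      \<open>E (N - k)\<^sup>+\<close>. For \<open>k > z\<close> the positive part is linear on the
      whole tail, so the centred tail is linear in \<open>tail_mean k\<close> and
      \<open>tail_mass k\<close>.\<close>
    define D where "D = z + e - r * q / p"
    define T where "T = tail_mean k - real k * tail_mass k"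
    have "centred_tail k = (\<Sum>n. real (k + n) * w (k + n) - (z + e) * w (k + n))"
      unfolding centred_tail_def using False by (intro suminf_cong) (auto simp: max_def algebra_simps)
    also have "\<dots> = tail_mean k - (z + e) * tail_mass k"
      unfolding tail_mass_def tail_mean_def using w_summable_shift mean_summable_shift
      by (subst suminf_diff[symmetric]) (auto intro!: summable_mult simp: suminf_mult)
    finally have Rk: "centred_tail k = tail_mean k - (z + e) * tail_mass k" .
    have hk: "h k = real k - z" using False by simp
    have kw: "real k * w k = p * tail_mean k - q * r * tail_mass k" using tail_mean_eq by simp
    have "?N = (real k - q * (r + real k)) * (tail_mean k - (z + e) * tail_mass k) - (real k - (z + e)) * (real k * w k)"
      unfolding centred_tail_Suc Rk hk by (simp add: algebra_simps)
    also have "\<dots> = (p * (z + e) - r * q) * T"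
      unfolding kw T_def q_eq by (simp add: algebra_simps)
    also have "p * (z + e) - r * q = p * D"
      unfolding D_def using p_pos by (simp add: algebra_simps)
    finally have N: "?N = p * D * T" .
    have D: "0 \<le> D" "D \<le> z" unfolding D_def using shortfall_bounds by auto
    have T: "0 \<le> T"
      unfolding T_def tail_first_moment(1)[symmetric]
      by (intro suminf_nonneg tail_first_moment) (simp add: w_nonneg)
    have "max 1 z * ?N = p * (D * (max 1 z * T))" unfolding N by simp
    also have "\<dots> \<le> p * (real k * tail_moment k)"
      unfolding T_def
      using D False p_pos T assms T_def
      by (intro mult_left_mono mult_mono tail_first_moment_le mult_nonneg_nonneg) auto
    finally show ?thesis using N D T p_pos by (simp add: mult.assoc)
  qed
  then have N: "0 \<le> ?N" "max 1 z * ?N \<le> p * real k * tail_moment k" by auto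
  have pos: "real k * (real (Suc k) * w (Suc k)) > 0" using assms w_pos by (intro mult_pos_pos) auto
  show ?lower
    unfolding stein_g_diff[OF assms] using N(1) pos by (intro divide_nonneg_pos)
  have "max 1 z * ?N \<le> p * real k * (real (Suc k) * w (Suc k) * p powr (- (r + 2)))"
    by (rule order_trans[OF N(2) mult_left_mono[OF tail_moment_bound[OF assms]]]) (use p_pos in simp)
  also have "\<dots> = p powr (- (r + 1)) * (real k * (real (Suc k) * w (Suc k)))"
  proof -
    \<comment> \<open>The extra factor \<open>p\<close> of the numerator improves the exponent
      \<open>r + 2\<close> of the majorant to \<open>r + 1\<close>.\<close>
    have "p powr (- (r + 1)) = p powr (1 + - (r + 2))" by (simp add: algebra_simps)
    also have "\<dots> = p * p powr (- (r + 2))" unfolding powr_add using p_pos by simp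
    finally show ?thesis by (simp only: mult_ac)
  qed
  finally show ?upper
    unfolding stein_g_diff[OF assms] using pos by (simp only: pos_divide_le_eq times_divide_eq_right)
qed

text \<open>Serves integrability only, so the constant is crude: \<open>\<bar>h - e\<bar>\<close> is
  enlarged until the series for \<open>tail_moment\<close> reappears.\<close>

lemma stein_g_bounded: "\<exists>K. \<forall>k. \<bar>stein_g r p z k\<bar> \<le> K"
proof -
  let ?K = "(1 + e) * p powr (- (r + 2))"
  have "\<bar>stein_g r p z (Suc k)\<bar> \<le> ?K" if "k \<ge> 1" for k
  proof -
    have le: "norm (w (Suc k + n) * (h (Suc k + n) - e))
        \<le> (1 + e) * (real (n + 1) * real (Suc k + n) * w (Suc k + n))" for n
    proof -
      have "\<bar>h (Suc k + n) - e\<bar> \<le> real (Suc k + n) + e"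
        using z_nonneg excess_nonneg by (auto simp: max_def)
      also have "\<dots> \<le> (1 + e) * real (Suc k + n)"
        using excess_nonneg by (simp add: algebra_simps)
      also have "\<dots> \<le> (1 + e) * (real (n + 1) * real (Suc k + n))"
        using excess_nonneg by (intro mult_left_mono) auto
      finally have "\<bar>h (Suc k + n) - e\<bar> \<le> (1 + e) * (real (n + 1) * real (Suc k + n))" .
      then have "w (Suc k + n) * \<bar>h (Suc k + n) - e\<bar>
          \<le> w (Suc k + n) * ((1 + e) * (real (n + 1) * real (Suc k + n)))"
        by (intro mult_left_mono w_nonneg)
      then show ?thesis using w_nonneg[of "Suc k + n"] by (simp only: real_norm_def abs_mult abs_of_nonneg mult_ac)
    qed
    have "\<bar>centred_tail (Suc k)\<bar> \<le> (\<Sum>n. (1 + e) * (real (n + 1) * real (Suc k + n) * w (Suc k + n)))"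
      unfolding centred_tail_def
      using norm_suminf_le[OF le summable_mult[OF tail_moment_summable[OF that]]] by simp
    also have "\<dots> = (1 + e) * tail_moment k"
      unfolding tail_moment_def by (rule suminf_mult[OF tail_moment_summable[OF that]])
    also have "\<dots> \<le> (1 + e) * (real (Suc k) * w (Suc k) * p powr (- (r + 2)))"
      using excess_nonneg by (intro mult_left_mono tail_moment_bound that) auto
    finally have "\<bar>centred_tail (Suc k)\<bar> \<le> ?K * (real (Suc k) * w (Suc k))" by (simp only: mult_ac)
    moreover have "real (Suc k) * w (Suc k) > 0" using w_pos by (intro mult_pos_pos) auto
    ultimately show ?thesis
      unfolding stein_g_Suc
      by (simp only: abs_divide abs_of_pos pos_divide_le_eq abs_minus_cancel)
  qed
  \<comment> \<open>The tail estimate needs \<open>k \<ge> 1\<close> and thus reaches arguments from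
    2 onwards; the values at 0 and 1 are added by hand.\<close>
  then have "\<bar>stein_g r p z k\<bar> \<le> max ?K \<bar>stein_g r p z 1\<bar>" for k
  proof -
    consider "k = 0" | "k = 1" | j where "k = Suc j" "j \<ge> 1"
      by (metis One_nat_def Suc_pred less_one linorder_not_less neq0_conv)
    then show ?thesis
      using \<open>\<And>k. k \<ge> 1 \<Longrightarrow> \<bar>stein_g r p z (Suc k)\<bar> \<le> ?K\<close>
      by cases (auto simp: stein_g_def[of r p z 0] le_max_iff_disj)
  qed
  then show ?thesis by blast
qed

end

end

section \<open>Smoothing of sums of independent integer variables\<close>

definition cos_int :: "nat \<Rightarrow> real" where
  "cos_int m = integral {0..pi} (\<lambda>t. cos t ^ m)"

lemma cos_int_0: "cos_int 0 = pi"
  by (simp add: cos_int_def)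

lemma cos_int_1: "cos_int 1 = 0"
proof -
  have "((\<lambda>t. cos t) has_integral (sin pi - sin 0)) {0..pi}"
    by (intro fundamental_theorem_of_calculus)
       (auto intro!: derivative_eq_intros simp: has_real_derivative_iff_has_vector_derivative[symmetric])
  then show ?thesis by (simp add: cos_int_def integral_unique)
qed

lemma cos_pow_integrable: "(\<lambda>t. cos t ^ m :: real) integrable_on {0..pi}"
  by (intro integrable_continuous_real continuous_intros)

text \<open>Integration by parts: \<open>sin t * cos t ^ (m + 1)\<close> vanishes at 0 and
  \<open>pi\<close>, and its derivative is the difference of the two integrands.\<close>

lemma cos_int_rec: "real (m + 2) * cos_int (m + 2) = real (m + 1) * cos_int m"
proof -
  have "((\<lambda>t. real (m + 2) * cos t ^ (m + 2) - real (m + 1) * cos t ^ m)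
          has_integral (sin pi * cos pi ^ (m + 1) - sin 0 * cos 0 ^ (m + 1))) {0..pi}"
  proof (intro fundamental_theorem_of_calculus)
    fix t :: real
    have "(sin has_real_derivative cos t) (at t within {0..pi})"
      by (auto intro!: derivative_eq_intros)
    moreover have "((\<lambda>t. cos t ^ Suc m) has_real_derivative (1 + real m) * (- sin t * cos t ^ m)) (at t within {0..pi})"
      by (intro DERIV_power_Suc) (auto intro!: derivative_eq_intros)
    ultimately have "((\<lambda>t. sin t * cos t ^ Suc m) has_real_derivative
        cos t * cos t ^ Suc m + (1 + real m) * (- sin t * cos t ^ m) * sin t) (at t within {0..pi})"
      by (rule DERIV_mult)
    then have "((\<lambda>t. sin t * cos t ^ (m + 1)) has_real_derivative
        (cos t * cos t ^ (m + 1) - real (m + 1) * cos t ^ m * (sin t)\<^sup>2)) (at t within {0..pi})"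
      by (simp add: power2_eq_square algebra_simps)
    also have "cos t * cos t ^ (m + 1) - real (m + 1) * cos t ^ m * (sin t)\<^sup>2
        = real (m + 2) * cos t ^ (m + 2) - real (m + 1) * cos t ^ m"
      unfolding sin_squared_eq by (simp add: power2_eq_square algebra_simps)
    finally show "((\<lambda>t. sin t * cos t ^ (m + 1)) has_vector_derivative
        real (m + 2) * cos t ^ (m + 2) - real (m + 1) * cos t ^ m) (at t within {0..pi})"
      by (simp add: has_real_derivative_iff_has_vector_derivative)
  qed simp
  moreover have "((\<lambda>t. real (m + 2) * cos t ^ (m + 2) - real (m + 1) * cos t ^ m)
          has_integral (real (m + 2) * cos_int (m + 2) - real (m + 1) * cos_int m)) {0..pi}"
    unfolding cos_int_def
    by (intro has_integral_diff has_integral_mult_right integrable_integral cos_pow_integrable)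
  ultimately have "sin pi * cos pi ^ (m + 1) - sin 0 * cos 0 ^ (m + 1)
      = real (m + 2) * cos_int (m + 2) - real (m + 1) * cos_int m"
    by (rule has_integral_unique)
  then show ?thesis by (simp del: of_nat_add)
qed

lemma cos_int_odd: "cos_int (2 * n + 1) = 0"
proof (induction n)
  case 0
  show ?case using cos_int_1 by simp
next
  case (Suc n)
  show ?case using cos_int_rec[of "2 * n + 1"] Suc by (simp del: of_nat_Suc of_nat_add)
qed

text \<open>Two uses of the absorption identity, passing through \<open>2 n + 1\<close> and the
  symmetry of its two middle coefficients. The result matches the recursion for even cosine
  integrals.\<close>

lemma central_binomial_Suc:
  "real (n + 1) * real ((2 * n + 2) choose (n + 1)) = 2 * real (2 * n + 1) * real ((2 * n) choose n)"
proof -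
  have "(n + 1) * ((2 * n + 2) choose (n + 1)) = (2 * n + 2) * ((2 * n + 1) choose n)"
    using Suc_times_binomial_eq[of "2 * n + 1" n] by simp
  moreover have "(n + 1) * ((2 * n + 1) choose n) = (2 * n + 1) * ((2 * n) choose n)"
    using Suc_times_binomial_eq[of "2 * n" n] binomial_symmetric[of n "2 * n + 1"] by simp
  ultimately have "(n + 1) * ((n + 1) * ((2 * n + 2) choose (n + 1)))
      = (n + 1) * (2 * (2 * n + 1) * ((2 * n) choose n))"
    by (simp add: algebra_simps)
  then have "(n + 1) * ((2 * n + 2) choose (n + 1)) = 2 * (2 * n + 1) * ((2 * n) choose n)"
    by (metis add_is_0 mult_cancel1 one_neq_zero)
  then show ?thesis by (metis (no_types, lifting) of_nat_mult of_nat_numeral)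
qed

lemma cos_int_even: "cos_int (2 * n) = pi * real ((2 * n) choose n) / 4 ^ n"
proof (induction n)
  case 0
  show ?case by (simp add: cos_int_0)
next
  case (Suc n)
  let ?c = "\<lambda>n. real ((2 * n) choose n)"
  have "2 * (real (n + 1) * cos_int (2 * Suc n)) = real (2 * n + 1) * cos_int (2 * n)"
    using cos_int_rec[of "2 * n"] by (simp add: algebra_simps)
  also have "\<dots> = pi / 4 ^ n / 2 * (2 * real (2 * n + 1) * ?c n)"
    unfolding Suc by (simp add: field_simps)
  also have "\<dots> = 2 * (real (n + 1) * (pi * ?c (Suc n) / 4 ^ Suc n))"
    unfolding central_binomial_Suc[symmetric] by (simp add: field_simps)
  finally show ?case by (simp only: mult_cancel_left) simp
qed

text \<open>Exactly one of \<open>m\<close> and \<open>m + 1\<close> is odd, and that integral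
  vanishes. The combined weight \<open>1 + cos t\<close> thus treats both parities with one
  formula.\<close>

lemma central_binomial_cos_int:
  "real (m choose (m div 2)) / 2 ^ m = (cos_int m + cos_int (m + 1)) / pi"
proof (cases "even m")
  case True
  then obtain n where m: "m = 2 * n" by blast
  then show ?thesis
    using cos_int_even[of n] cos_int_odd[of n] by (simp add: power_mult)
next
  case False
  then obtain n where m: "m = 2 * n + 1" using oddE by blast
  have "(m + 1) choose (n + 1) = 2 * (m choose n)"
    using binomial_symmetric[of n "2 * n + 1"] m by simp
  moreover have "cos_int (m + 1) = pi * real ((m + 1) choose (n + 1)) / 4 ^ (n + 1)"
    using cos_int_even[of "n + 1"] m by simp
  moreover have "cos_int m = 0" using cos_int_odd m by simp
  moreover have "(2::real) ^ m * 2 = 4 ^ (n + 1)"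
    unfolding m by (simp add: power_mult)
  moreover have "m div 2 = n" using m by simp
  ultimately show ?thesis by (simp add: field_simps)
qed

section \<open>A Gaussian bound for cosine integrals\<close>

lemma gaussian_interval_le:
  fixes c :: real
  assumes "c > 0"
  shows "integral {0..1} (\<lambda>x. exp (- c * x\<^sup>2)) \<le> sqrt (pi / c) / 2"
proof -
  define s where "s = sqrt c"
  have s: "s > 0" "s\<^sup>2 = c" using assms by (auto simp: s_def)
  have "has_bochner_integral lborel (\<lambda>x. indicator {0..} (0 + s * x) *\<^sub>R exp (- (0 + s * x)\<^sup>2))
          ((sqrt pi / 2) /\<^sub>R \<bar>s\<bar>)"
    using s gaussian_moment_0 by (subst lborel_has_bochner_integral_real_affine_iff[symmetric]) auto
  also have "(\<lambda>x. indicator {0..} (0 + s * x) *\<^sub>R exp (- (0 + s * x)\<^sup>2))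
      = (\<lambda>x. if x \<in> {0..} then exp (- c * x\<^sup>2) else 0)"
    using s by (auto simp: indicator_def zero_le_mult_iff power_mult_distrib)
  also have "(sqrt pi / 2) /\<^sub>R \<bar>s\<bar> = sqrt (pi / c) / 2"
    using s by (simp add: s_def real_sqrt_divide field_simps)
  finally have hb: "has_bochner_integral lborel (\<lambda>x. if x \<in> {0..} then exp (- c * x\<^sup>2) else 0) (sqrt (pi / c) / 2)" .
  then have "((\<lambda>x. if x \<in> {0..} then exp (- c * x\<^sup>2) else 0) has_integral (sqrt (pi / c) / 2)) UNIV"
    using has_integral_integral_lborel[of "\<lambda>x. if x \<in> {0..} then exp (- c * x\<^sup>2) else 0"]
    unfolding has_bochner_integral_iff by metis
  then have "((\<lambda>x. exp (- c * x\<^sup>2)) has_integral (sqrt (pi / c) / 2)) {0..}"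
    by (rule has_integral_restrict_UNIV[THEN iffD1])
  moreover have "((\<lambda>x. exp (- c * x\<^sup>2)) has_integral integral {0..1} (\<lambda>x. exp (- c * x\<^sup>2))) {0..1}"
    by (intro integrable_integral integrable_continuous_real continuous_intros)
  ultimately show ?thesis
    by (intro has_integral_subset_le[of "{0..1}" "{0..}"]) auto
qed

text \<open>With \<open>x = sin (t / 2)\<close> one has \<open>1 - cos t = 2 x\<^sup>2\<close> and
  \<open>1 + cos t = 2 cos (t / 2)\<^sup>2\<close>. One factor \<open>cos (t / 2)\<close> supplies
  \<open>dx\<close>; the other is at most \<open>exp (- x\<^sup>2 / 2)\<close>. This adds
  \<open>1 / 2\<close> to the exponent \<open>2 l\<close>, and after halving it becomes the
  \<open>1 / 4\<close> of the statement.\<close>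

lemma cos_gaussian_bound:
  fixes l :: real
  assumes "l \<ge> 0"
  shows "integral {0..pi} (\<lambda>t. (1 + cos t) * exp (- l * (1 - cos t))) / pi
           \<le> sqrt (2 / pi) * (1 / 4 + l) powr (- 1 / 2)"
proof -
  define c where "c = 2 * l + 1 / 2"
  have c: "c > 0" using assms by (simp add: c_def)
  let ?f = "\<lambda>x::real. exp (- c * x\<^sup>2)"
  have sub: "((\<lambda>t. (cos (t / 2) / 2) *\<^sub>R ?f (sin (t / 2))) has_integral
      integral {sin (0 / 2)..sin (pi / 2)} ?f) {0..pi}"
    by (rule has_integral_substitution[where c = "-1" and d = 1])
       (auto intro!: continuous_intros derivative_eq_intros)
  then have sub': "((\<lambda>t. 4 * ((cos (t / 2) / 2) * ?f (sin (t / 2)))) has_integral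
      4 * integral {0..1} ?f) {0..pi}"
    by (intro has_integral_mult_right) simp
  have "integral {0..pi} (\<lambda>t. (1 + cos t) * exp (- l * (1 - cos t))) \<le> 4 * integral {0..1} ?f"
  proof (rule has_integral_le[OF integrable_integral sub'])
    show "(\<lambda>t. (1 + cos t) * exp (- l * (1 - cos t))) integrable_on {0..pi}"
      by (intro integrable_continuous_real continuous_intros)
  next
    fix t :: real assume t: "t \<in> {0..pi}"
    define x where "x = sin (t / 2)"
    define y where "y = cos (t / 2)"
    have y0: "y \<ge> 0" unfolding y_def using t by (intro cos_ge_zero) auto
    have xy: "y\<^sup>2 = 1 - x\<^sup>2" unfolding x_def y_def by (simp add: cos_squared_eq)
    have ct: "cos t = 1 - 2 * x\<^sup>2"
      using cos_double_sin[of "t / 2"] by (simp add: x_def)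
    have "y\<^sup>2 \<le> (exp (- x\<^sup>2 / 2))\<^sup>2"
      using exp_ge_add_one_self[of "- x\<^sup>2"] by (simp add: xy exp_double[symmetric])
    then have ye: "y \<le> exp (- x\<^sup>2 / 2)"
      by (rule power2_le_imp_le) simp
    have "1 + cos t = 2 * y\<^sup>2" using xy by (simp add: ct)
    then have "(1 + cos t) * exp (- l * (1 - cos t)) = 2 * y * (y * exp (- 2 * l * x\<^sup>2))"
      by (simp add: ct power2_eq_square mult_ac)
    also have "\<dots> \<le> 2 * y * (exp (- x\<^sup>2 / 2) * exp (- 2 * l * x\<^sup>2))"
      using y0 ye by (intro mult_left_mono mult_right_mono) auto
    also have "exp (- x\<^sup>2 / 2) * exp (- 2 * l * x\<^sup>2) = ?f x"
      by (simp add: exp_add[symmetric] c_def algebra_simps)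
    finally show "(1 + cos t) * exp (- l * (1 - cos t)) \<le> 4 * (cos (t / 2) / 2 * ?f (sin (t / 2)))"
      by (simp add: x_def y_def)
  qed
  also have "\<dots> \<le> 4 * (sqrt (pi / c) / 2)"
    using gaussian_interval_le[OF c] by simp
  also have "\<dots> = pi * (sqrt (2 / pi) * (1 / 4 + l) powr (- 1 / 2))"
  proof -
    have "(1 / 4 + l) powr (- 1 / 2) = 1 / sqrt (1 / 4 + l)"
    proof -
      have "(1 / 4 + l) powr (- 1 / 2) = inverse ((1 / 4 + l) powr (1 / 2))"
        unfolding powr_minus[symmetric] by simp
      then show ?thesis using assms powr_half_sqrt[of "1 / 4 + l"] by (simp add: inverse_eq_divide)
    qed
    moreover have "2 * sqrt (pi / c) = sqrt (2 * pi) / sqrt (1 / 4 + l)"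
    proof -
      have "2 * sqrt (pi / c) = sqrt (4 * (pi / c))" by (simp only: real_sqrt_mult real_sqrt_four)
      also have "4 * (pi / c) = 2 * pi / (1 / 4 + l)" using assms by (simp add: c_def field_simps)
      finally show ?thesis by (simp only: real_sqrt_divide)
    qed
    moreover have "pi * sqrt (2 / pi) = sqrt (2 * pi)"
    proof -
      have "pi * sqrt (2 / pi) = sqrt (pi\<^sup>2) * sqrt (2 / pi)" by simp
      also have "\<dots> = sqrt (pi\<^sup>2 * (2 / pi))" by (simp only: real_sqrt_mult)
      also have "pi\<^sup>2 * (2 / pi) = 2 * pi" by (simp add: power2_eq_square)
      finally show ?thesis .
    qed
    ultimately show ?thesis by simp
  qed
  finally show ?thesis by (simp add: field_simps)
qed

section \<open>Overlap of a law with its shift\<close>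

lemma overlap_summable:
  fixes f :: "nat \<Rightarrow> real"
  assumes "\<And>k. f k \<ge> 0" "f sums s"
  shows "summable (\<lambda>k. min (f k) (f (Suc k)))"
  by (rule summable_comparison_test'[OF sums_summable[OF assms(2)], of 0]) (simp add: assms(1))

text \<open>Follows from \<open>\<bar>a - b\<bar> = a + b - 2 min a b\<close>. The shifted law puts
  no mass at 0, so the distance there is \<open>f 0\<close>, which makes up for the mass missing
  from the shifted sum.\<close>

lemma dtv_nat_overlap:
  fixes f :: "nat \<Rightarrow> real"
  assumes nonneg: "\<And>k. f k \<ge> 0" and f: "f sums 1"
    and g: "g 0 = 0" "\<And>k. g (Suc k) = f k"
  shows "1 - dtv_nat f g = (\<Sum>k. min (f k) (f (Suc k)))"
proof -
  note sm = overlap_summable[OF nonneg f]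
  have Sf: "(\<lambda>k. f (Suc k)) sums (1 - f 0)"
    using f by (simp add: sums_Suc_iff)
  have "\<bar>f (Suc k) - g (Suc k)\<bar> = f k + f (Suc k) - 2 * min (f k) (f (Suc k))" for k
    by (auto simp: g)
  then have "(\<lambda>k. \<bar>f (Suc k) - g (Suc k)\<bar>) sums (1 + (1 - f 0) - 2 * (\<Sum>k. min (f k) (f (Suc k))))"
    using sums_diff[OF sums_add[OF f Sf] sums_mult[OF summable_sums[OF sm], of 2]] by simp
  then have "(\<lambda>k. \<bar>f k - g k\<bar>) sums (1 + (1 - f 0) - 2 * (\<Sum>k. min (f k) (f (Suc k))) + \<bar>f 0 - g 0\<bar>)"
    by (subst (asm) sums_Suc_iff) (simp add: algebra_simps)
  then show ?thesis
    using nonneg[of 0] by (simp add: dtv_nat_def sums_iff g diff_divide_distrib)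
qed

text \<open>Pairing neighbouring atoms splits the weights into a part of mass \<open>d\<close> that is a mixture of
  uniform distributions on two neighbouring points, and a remainder of mass \<open>1 - d\<close>.\<close>

lemma overlap_mixture_bound:
  fixes f \<phi> :: "nat \<Rightarrow> real"
  assumes nonneg: "\<And>k. f k \<ge> 0" and f: "f sums 1"
    and d: "0 \<le> d" "d \<le> (\<Sum>k. min (f k) (f (Suc k)))"
    and a: "\<And>k. \<bar>\<phi> k\<bar> \<le> a" and b: "\<And>k. \<bar>\<phi> k + \<phi> (Suc k)\<bar> / 2 \<le> b"
  shows "\<bar>\<Sum>k. f k * \<phi> k\<bar> \<le> (1 - d) * a + d * b"
proof -
  define u where "u = (\<Sum>k. min (f k) (f (Suc k)))"
  \<comment> \<open>The available overlap \<open>u\<close> may exceed \<open>d\<close>, so it is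
    scaled down to mass \<open>d\<close>. If \<open>u = 0\<close> then \<open>d = 0\<close> as
    well.\<close>
  define \<tau> where "\<tau> = (if u = 0 then 0 else d / u)"
  define v where "v k = \<tau> * min (f k) (f (Suc k))" for k
  \<comment> \<open>The pair \<open>k\<close>, \<open>k + 1\<close> carries mass \<open>v k\<close>,
    half on each point; \<open>v'\<close> records the halves landing on the upper points.\<close>
  define v' where "v' k = (case k of 0 \<Rightarrow> 0 | Suc j \<Rightarrow> v j)" for k
  define rest where "rest k = f k - (v k + v' k) / 2" for k
  note sm = overlap_summable[OF nonneg f]
  have u: "0 \<le> u" unfolding u_def by (intro suminf_nonneg sm) (simp add: nonneg)
  have \<tau>: "0 \<le> \<tau>" "\<tau> \<le> 1" "\<tau> * u = d"
  proof -
    have "d \<le> u" using d by (simp add: u_def)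
    then show "0 \<le> \<tau>" "\<tau> \<le> 1" "\<tau> * u = d" using d(1) u by (auto simp: \<tau>_def)
  qed
  have v_nonneg: "0 \<le> v k" for k using \<tau> nonneg by (simp add: v_def)
  have v_le: "v k \<le> f k" "v k \<le> f (Suc k)" for k
  proof -
    have "v k \<le> 1 * min (f k) (f (Suc k))"
      unfolding v_def using \<tau> nonneg by (intro mult_right_mono) auto
    then show "v k \<le> f k" "v k \<le> f (Suc k)" by auto
  qed
  have v_sums: "v sums d"
    unfolding v_def using sums_mult[OF summable_sums[OF sm], of \<tau>] \<tau>(3) by (simp add: u_def)
  have v'_sums: "v' sums d"
    using v_sums sums_Suc_iff[of v' d] by (simp add: v'_def)
  have rest_sums: "rest sums (1 - d)"
    unfolding rest_def using sums_diff[OF f sums_divide[OF sums_add[OF v_sums v'_sums], of 2]] by simp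
  \<comment> \<open>Point \<open>k\<close> gives half of \<open>v k\<close> and half of
    \<open>v (k - 1)\<close>, each of which is at most \<open>f k\<close>; point 0 belongs to one
    pair only.\<close>
  have rest_nonneg: "0 \<le> rest k" for k
    using v_le[of k] v_le(2)[of "k - 1"] nonneg[of k] unfolding rest_def v'_def by (cases k) auto
  have bdd: "summable (\<lambda>k. c k * \<phi> k)" if "c sums s" "\<And>k. 0 \<le> c k" for c s
  proof (rule summable_comparison_test'[OF summable_mult2[OF sums_summable[OF that(1)], of a], of 0])
    show "norm (c n * \<phi> n) \<le> c n * a" for n
      using that(2)[of n] a[of n] by (simp add: abs_mult mult_left_mono)
  qed
  have v'_nonneg: "0 \<le> v' k" for k using v_nonneg by (simp add: v'_def split: nat.split)
  note S = bdd[OF v_sums v_nonneg] bdd[OF v'_sums v'_nonneg] bdd[OF rest_sums rest_nonneg]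
  have "(\<Sum>k. v' k * \<phi> k) = (\<Sum>k. v k * \<phi> (Suc k))"
    using suminf_split_head[OF S(2)] by (simp add: v'_def)
  moreover have S2: "summable (\<lambda>k. v k * \<phi> (Suc k))"
    using S(2) by (subst (asm) summable_Suc_iff[symmetric]) (simp add: v'_def)
  ultimately have pair: "(\<Sum>k. v k * \<phi> k) + (\<Sum>k. v' k * \<phi> k) = (\<Sum>k. v k * (\<phi> k + \<phi> (Suc k)))"
    using suminf_add[OF S(1) S2] by (simp add: distrib_left)
  have "(\<lambda>k. ((v k * \<phi> k + v' k * \<phi> k) / 2) + rest k * \<phi> k) sums
     (((\<Sum>k. v k * \<phi> k) + (\<Sum>k. v' k * \<phi> k)) / 2 + (\<Sum>k. rest k * \<phi> k))"
    by (intro sums_add sums_divide summable_sums S)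
  moreover have "((v k * \<phi> k + v' k * \<phi> k) / 2) + rest k * \<phi> k = f k * \<phi> k" for k
    unfolding rest_def by (simp add: field_simps)
  ultimately have eq: "(\<Sum>k. f k * \<phi> k)
      = (\<Sum>k. v k * (\<phi> k + \<phi> (Suc k))) / 2 + (\<Sum>k. rest k * \<phi> k)"
    using pair by (simp add: sums_iff)
  have "\<bar>\<Sum>k. v k * (\<phi> k + \<phi> (Suc k))\<bar> \<le> (\<Sum>k. v k * (2 * b))"
  proof -
    have le: "norm (v k * (\<phi> k + \<phi> (Suc k))) \<le> v k * (2 * b)" for k
      using v_nonneg[of k] b[of k] by (simp add: abs_mult mult_left_mono)
    show ?thesis
      using norm_suminf_le[OF le summable_mult2[OF sums_summable[OF v_sums]]] by simp
  qed
  also have "\<dots> = d * (2 * b)" using sums_mult2[OF v_sums] by (simp add: sums_iff)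
  finally have 1: "\<bar>(\<Sum>k. v k * (\<phi> k + \<phi> (Suc k))) / 2\<bar> \<le> d * b" by simp
  have "\<bar>\<Sum>k. rest k * \<phi> k\<bar> \<le> (\<Sum>k. rest k * a)"
  proof -
    have le: "norm (rest k * \<phi> k) \<le> rest k * a" for k
      using rest_nonneg[of k] a[of k] by (simp add: abs_mult mult_left_mono)
    show ?thesis
      using norm_suminf_le[OF le summable_mult2[OF sums_summable[OF rest_sums]]] by simp
  qed
  also have "\<dots> = (1 - d) * a" using sums_mult2[OF rest_sums] by (simp add: sums_iff)
  finally show ?thesis using 1 unfolding eq by linarith
qed

section \<open>Averaging over fair coin flips\<close>

text \<open>Summation by parts along the two branches. While \<open>b\<close> rises, the partial sum
  stays below \<open>b j * F j\<close>; once it falls, below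
  \<open>C * b h - b i * (C - F (Suc i))\<close>. Using \<open>F\<close> and \<open>C - F\<close> in
  turn, both nonnegative, yields the constant \<open>C\<close> rather than
  \<open>2 C\<close>.\<close>

lemma unimodal_sum_diff_le:
  fixes b F :: "nat \<Rightarrow> real"
  assumes b: "\<And>k. 0 \<le> b k" and F: "\<And>k. 0 \<le> F k" "\<And>k. F k \<le> C"
    and incr: "\<And>k. k < h \<Longrightarrow> b k \<le> b (Suc k)" and decr: "\<And>k. h \<le> k \<Longrightarrow> b (Suc k) \<le> b k"
  shows "(\<Sum>k<j. b k * (F (Suc k) - F k)) \<le> C * b h"
proof -
  have C: "0 \<le> C" using F[of 0] by simp
  have up: "(\<Sum>k<j. b k * (F (Suc k) - F k)) \<le> b j * F j" if "j \<le> h" for j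
    using that
  proof (induction j)
    case 0
    then show ?case using b F by simp
  next
    case (Suc j)
    have "b j * F (Suc j) \<le> b (Suc j) * F (Suc j)"
      using Suc.prems F by (intro mult_right_mono incr) auto
    then show ?case using Suc by (simp add: algebra_simps)
  qed
  have down: "(\<Sum>k<Suc i. b k * (F (Suc k) - F k)) \<le> C * b h - b i * (C - F (Suc i))" if "h \<le> i" for i
    using that
  proof (induction i rule: dec_induct)
    case base
    show ?case using up[of h] by (simp add: algebra_simps)
  next
    case (step i)
    have "b (Suc i) * (C - F (Suc i)) \<le> b i * (C - F (Suc i))"
      using F step by (intro mult_right_mono decr) auto
    then show ?case using step.IH by (simp add: algebra_simps)
  qed
  show ?thesis
  proof (cases "j \<le> h")
    case True
    have "b j \<le> b h"
      using True by (induction rule: inc_induct) (auto intro: order_trans[OF incr])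
    then have "b j * F j \<le> b h * C" using F b by (intro mult_mono) auto
    then show ?thesis using up[OF True] by (simp add: mult.commute)
  next
    case False
    then obtain i where i: "j = Suc i" "h \<le> i" by (cases j) auto
    have "0 \<le> b i * (C - F (Suc i))" using b F by (intro mult_nonneg_nonneg) auto
    then show ?thesis unfolding i using down[OF i(2)] by linarith
  qed
qed

text \<open>The effect of adding one fair coin flip: \<open>(avg ^^ m) f n\<close> is the
  expectation of \<open>f (n + B)\<close> with \<open>B\<close> binomial with parameters
  \<open>m\<close> and \<open>1 / 2\<close>.\<close>

definition avg :: "(nat \<Rightarrow> real) \<Rightarrow> nat \<Rightarrow> real" where
  "avg f n = (f n + f (Suc n)) / 2"

lemma avg_pow_shift: "(avg ^^ m) (\<lambda>n. f (k + n)) n = (avg ^^ m) f (k + n)"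
  by (induction m arbitrary: n) (auto simp: avg_def)

lemma avg_pow_Suc: "(avg ^^ Suc m) f n = ((avg ^^ m) f n + (avg ^^ m) f (Suc n)) / 2"
  by (simp add: avg_def)

lemma avg_pow_bounds:
  assumes "\<And>n. 0 \<le> f n" "\<And>n. f n \<le> C"
  shows "0 \<le> (avg ^^ m) f n" "(avg ^^ m) f n \<le> C"
proof -
  have "0 \<le> (avg ^^ m) f n \<and> (avg ^^ m) f n \<le> C"
  proof (induction m arbitrary: n)
    case 0
    then show ?case using assms by simp
  next
    case (Suc m)
    show ?case using Suc[of n] Suc[of "Suc n"] unfolding avg_pow_Suc by auto
  qed
  then show "0 \<le> (avg ^^ m) f n" "(avg ^^ m) f n \<le> C" by auto
qed

lemma avg_pow_binomial: "(avg ^^ m) f n = (\<Sum>k\<le>m. real (m choose k) * f (n + k)) / 2 ^ m"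
proof (induction m arbitrary: n)
  case 0
  show ?case by simp
next
  case (Suc m)
  have "(\<Sum>k\<le>Suc m. real (Suc m choose k) * f (n + k))
      = f n + (\<Sum>k\<le>m. real (m choose k) * f (n + Suc k) + real (m choose Suc k) * f (n + Suc k))"
    by (subst sum.atMost_Suc_shift) (simp add: algebra_simps)
  also have "\<dots> = (\<Sum>k\<le>m. real (m choose k) * f (Suc n + k))
      + (f n + (\<Sum>k\<le>m. real (m choose Suc k) * f (n + Suc k)))"
    by (simp add: sum.distrib)
  also have "f n + (\<Sum>k\<le>m. real (m choose Suc k) * f (n + Suc k)) = (\<Sum>k\<le>Suc m. real (m choose k) * f (n + k))"
    by (subst sum.atMost_Suc_shift) simp
  also have "\<dots> = (\<Sum>k\<le>m. real (m choose k) * f (n + k))" by simp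
  finally have eq: "(\<Sum>k\<le>Suc m. real (Suc m choose k) * f (n + k))
      = (\<Sum>k\<le>m. real (m choose k) * f (Suc n + k)) + (\<Sum>k\<le>m. real (m choose k) * f (n + k))" .
  show ?case
    unfolding avg_pow_Suc Suc.IH eq power_Suc
    by (simp only: add_divide_distrib divide_divide_eq_left mult.commute[of 2] add.commute)
qed

text \<open>Binomial coefficients are unimodal with a peak at \<open>m div 2\<close>. The functions
  \<open>f\<close> and \<open>C - f\<close> give the bounds from above and from below.\<close>

lemma avg_pow_diff_le:
  assumes "\<And>n. 0 \<le> f n" "\<And>n. f n \<le> C"
  shows "\<bar>(avg ^^ m) f (Suc n) - (avg ^^ m) f n\<bar> \<le> C * (real (m choose (m div 2)) / 2 ^ m)"
proof -
  let ?b = "\<lambda>k. real (m choose k)"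
  have incr: "?b k \<le> ?b (Suc k)" if "k < m div 2" for k
    using that by (intro of_nat_mono binomial_mono) auto
  have decr: "?b (Suc k) \<le> ?b k" if "m div 2 \<le> k" for k
    using that by (cases "Suc k \<le> m") (auto intro!: of_nat_mono binomial_antimono simp: binomial_eq_0)
  have "(avg ^^ m) f (Suc n) - (avg ^^ m) f n = (\<Sum>k<Suc m. ?b k * (f (n + Suc k) - f (n + k))) / 2 ^ m"
    unfolding avg_pow_binomial lessThan_Suc_atMost
    by (simp add: sum_subtractf right_diff_distrib diff_divide_distrib)
  moreover have "(\<Sum>k<Suc m. ?b k * (f (n + Suc k) - f (n + k))) \<le> C * ?b (m div 2)"
    by (rule unimodal_sum_diff_le) (use assms incr decr in auto)
  moreover have "(\<Sum>k<Suc m. ?b k * ((C - f (n + Suc k)) - (C - f (n + k)))) \<le> C * ?b (m div 2)"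
    by (rule unimodal_sum_diff_le[where F = "\<lambda>k. C - f (n + k)"]) (use assms incr decr in auto)
  moreover have "(\<Sum>k<Suc m. ?b k * ((C - f (n + Suc k)) - (C - f (n + k))))
      = - (\<Sum>k<Suc m. ?b k * (f (n + Suc k) - f (n + k)))"
    unfolding sum_negf[symmetric] by (intro sum.cong) (auto simp: algebra_simps)
  ultimately show ?thesis by (simp add: abs_le_iff divide_right_mono field_simps del: lessThan_Suc sum.lessThan_Suc)
qed

section \<open>The smoothing integral\<close>

text \<open>The mean of the central binomial weight when \<open>m\<close> flips are in hand and each
  \<open>j\<close> in \<open>I\<close> yields a further one with probability \<open>d j\<close>,
  independently. Each factor is the generating function of such an indicator at
  \<open>cos t\<close>.\<close>

definition smooth_int :: "('i \<Rightarrow> real) \<Rightarrow> 'i set \<Rightarrow> nat \<Rightarrow> real" where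
  "smooth_int d I m =
     integral {0..pi} (\<lambda>t. (1 + cos t) * cos t ^ m * (\<Prod>j\<in>I. 1 - d j + d j * cos t)) / pi"

lemma smooth_int_integrable:
  "(\<lambda>t. (1 + cos t) * cos t ^ m * (\<Prod>j\<in>I. 1 - d j + d j * cos t :: real)) integrable_on {0..pi}"
  by (intro integrable_continuous_real continuous_intros)

lemma smooth_int_empty: "smooth_int d {} m = real (m choose (m div 2)) / 2 ^ m"
proof -
  have "(\<lambda>t. (1 + cos t) * cos t ^ m * (\<Prod>j\<in>{}. 1 - d j + d j * cos t)) = (\<lambda>t. cos t ^ m + cos t ^ (m + 1))"
    by (simp add: fun_eq_iff algebra_simps)
  then show ?thesis
    unfolding central_binomial_cos_int smooth_int_def cos_int_def
    by (simp only: integral_add[OF cos_pow_integrable cos_pow_integrable])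
qed

text \<open>The new factor splits the integral according to whether \<open>j\<close> yields a
  flip.\<close>

lemma smooth_int_insert:
  assumes "finite I" "j \<notin> I"
  shows "smooth_int d (insert j I) m = (1 - d j) * smooth_int d I m + d j * smooth_int d I (Suc m)"
proof -
  let ?F = "\<lambda>m t. (1 + cos t) * cos t ^ m * (\<Prod>j\<in>I. 1 - d j + d j * cos t)"
  have "(\<lambda>t. (1 + cos t) * cos t ^ m * (\<Prod>j\<in>insert j I. 1 - d j + d j * cos t))
      = (\<lambda>t. (1 - d j) * ?F m t + d j * ?F (Suc m) t)"
    using assms by (auto simp: algebra_simps)
  moreover have "integral {0..pi} (\<lambda>t. (1 - d j) * ?F m t + d j * ?F (Suc m) t)
      = (1 - d j) * integral {0..pi} (?F m) + d j * integral {0..pi} (?F (Suc m))"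
    by (intro integral_unique has_integral_add has_integral_mult_right integrable_integral smooth_int_integrable)
  ultimately show ?thesis
    unfolding smooth_int_def by (simp only: add_divide_distrib times_divide_eq_right)
qed

lemma smooth_int_le:
  assumes "finite I" "\<And>j. j \<in> I \<Longrightarrow> 0 \<le> d j" "\<And>j. j \<in> I \<Longrightarrow> d j \<le> 1 / 2"
  shows "smooth_int d I 0 \<le> sqrt (2 / pi) * (1 / 4 + sum d I) powr (- 1 / 2)"
proof -
  have "smooth_int d I 0 \<le> integral {0..pi} (\<lambda>t. (1 + cos t) * exp (- sum d I * (1 - cos t))) / pi"
    unfolding smooth_int_def
  proof (intro divide_right_mono integral_le smooth_int_integrable)
    show "(\<lambda>t. (1 + cos t) * exp (- sum d I * (1 - cos t))) integrable_on {0..pi}"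
      by (intro integrable_continuous_real continuous_intros)
  next
    fix t :: real
    have c: "0 \<le> 1 - cos t" "1 - cos t \<le> 2" using cos_le_one[of t] cos_ge_minus_one[of t] by auto
    have "(\<Prod>j\<in>I. 1 - d j + d j * cos t) \<le> (\<Prod>j\<in>I. exp (- d j * (1 - cos t)))"
    proof (intro prod_mono conjI)
      fix j assume "j \<in> I"
      \<comment> \<open>The cap at \<open>1 / 2\<close> enters here: it makes each factor
        nonnegative, as the comparison of products requires.\<close>
      then have "d j * (1 - cos t) \<le> 1 / 2 * 2" using assms c by (intro mult_mono) auto
      then show "0 \<le> 1 - d j + d j * cos t" by (simp add: algebra_simps)
      show "1 - d j + d j * cos t \<le> exp (- d j * (1 - cos t))"
        using exp_ge_add_one_self[of "- d j * (1 - cos t)"] by (simp add: algebra_simps)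
    qed
    also have "\<dots> = exp (- sum d I * (1 - cos t))"
      using assms(1) by (simp add: exp_sum[symmetric] sum_distrib_right sum_negf[symmetric])
    finally have "(1 + cos t) * (\<Prod>j\<in>I. 1 - d j + d j * cos t)
        \<le> (1 + cos t) * exp (- sum d I * (1 - cos t))"
      using cos_ge_minus_one[of t] by (intro mult_left_mono) linarith+
    then show "(1 + cos t) * cos t ^ 0 * (\<Prod>j\<in>I. 1 - d j + d j * cos t)
        \<le> (1 + cos t) * exp (- sum d I * (1 - cos t))"
      by simp
  qed simp
  also have "\<dots> \<le> sqrt (2 / pi) * (1 / 4 + sum d I) powr (- 1 / 2)"
    by (intro cos_gaussian_bound sum_nonneg assms)
  finally show ?thesis .
qed

section \<open>Conditioning on integer variables and smoothing of sums\<close>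

context prob_space
begin

lemma integrable_bounded_comp:
  fixes f :: "nat \<Rightarrow> real"
  assumes "X \<in> measurable M (count_space UNIV)" "\<And>n. \<bar>f n\<bar> \<le> K"
  shows "integrable M (\<lambda>x. f (X x))"
proof (rule integrable_const_bound[of _ K])
  show "(\<lambda>x. f (X x)) \<in> borel_measurable M"
    by (rule measurable_compose[OF assms(1)]) simp
qed (simp add: assms(2))

text \<open>The partial sum over \<open>k < n\<close> is \<open>G\<close> restricted to
  \<open>X < n\<close>. It is eventually equal to \<open>G\<close> at each point and dominated by
  \<open>\<bar>G\<bar>\<close>.\<close>

lemma expectation_fibres:
  fixes G :: "'a \<Rightarrow> real" and X :: "'a \<Rightarrow> nat"
  assumes X: "X \<in> measurable M (count_space UNIV)" and G: "integrable M G"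
  shows "(\<lambda>k. expectation (\<lambda>x. indicator {x \<in> space M. X x = k} x * G x)) sums expectation G"
proof -
  let ?f = "\<lambda>k x. indicator {x \<in> space M. X x = k} x * G x"
  have fi: "integrable M (?f k)" for k
    using X by (intro integrable_real_mult_indicator[OF _ G, unfolded mult.commute[of "G _"]]) measurable
  have part: "(\<Sum>k<n. ?f k x) = (if X x < n then G x else 0)" if "x \<in> space M" for n x
  proof -
    have "(\<Sum>k<n. ?f k x) = (\<Sum>k<n. if k = X x then G x else 0)"
      using that by (intro sum.cong) (auto simp: indicator_def)
    then show ?thesis by (simp add: sum.delta)
  qed
  have "(\<lambda>n. expectation (\<lambda>x. \<Sum>k<n. ?f k x)) \<longlonglongrightarrow> expectation G"
  proof (rule integral_dominated_convergence[where w = "\<lambda>x. \<bar>G x\<bar>"])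
    show "AE x in M. (\<lambda>n. \<Sum>k<n. ?f k x) \<longlonglongrightarrow> G x"
    proof (rule AE_I2)
      fix x assume x: "x \<in> space M"
      have "eventually (\<lambda>n. (\<Sum>k<n. ?f k x) = G x) sequentially"
        using eventually_gt_at_top[of "X x"] by eventually_elim (simp add: part[OF x])
      then show "(\<lambda>n. \<Sum>k<n. ?f k x) \<longlonglongrightarrow> G x" by (rule tendsto_eventually)
    qed
    show "AE x in M. norm (\<Sum>k<n. ?f k x) \<le> \<bar>G x\<bar>" for n
      by (rule AE_I2) (simp only: part, simp)
  next
    show "(\<lambda>x. \<Sum>k<n. ?f k x) \<in> borel_measurable M" for n
      by (intro borel_measurable_sum borel_measurable_integrable fi)
  qed (use G in auto)
  moreover have "expectation (\<lambda>x. \<Sum>k<n. ?f k x) = (\<Sum>k<n. expectation (?f k))" for n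
    by (intro Bochner_Integration.integral_sum fi)
  ultimately show ?thesis by (simp only: sums_def)
qed

text \<open>On the fibre \<open>X = k\<close> the integrand is a function of \<open>Y\<close> alone,
  and the indicator of the fibre is independent of it.\<close>

lemma expectation_indep_fibres:
  fixes F :: "nat \<Rightarrow> nat \<Rightarrow> real"
  assumes ind: "indep_var (count_space UNIV) X (count_space UNIV) Y"
    and F: "integrable M (\<lambda>x. F (X x) (Y x))" "\<And>k. integrable M (\<lambda>x. F k (Y x))"
  shows "(\<lambda>k. pt_prob M X k * expectation (\<lambda>x. F k (Y x))) sums expectation (\<lambda>x. F (X x) (Y x))"
proof -
  have X: "X \<in> measurable M (count_space UNIV)" using ind by (rule indep_var_rv1)
  have "expectation (\<lambda>x. indicator {x \<in> space M. X x = k} x * F (X x) (Y x))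
      = pt_prob M X k * expectation (\<lambda>x. F k (Y x))" for k
  proof -
    have "indep_var borel ((\<lambda>n. indicator {k} n :: real) \<circ> X) borel (F k \<circ> Y)"
      by (rule indep_var_compose[OF ind]) auto
    then have iv: "indep_var borel (\<lambda>x. indicator {k} (X x) :: real) borel (\<lambda>x. F k (Y x))"
      by (simp add: comp_def)
    have "integrable M (\<lambda>x. indicator {k} (X x) :: real)"
      by (rule integrable_bounded_comp[OF X, of _ 1]) (auto simp: indicator_def)
    from indep_var_lebesgue_integral[OF iv this F(2)]
    have "expectation (\<lambda>x. indicator {k} (X x) * F k (Y x))
        = expectation (\<lambda>x. indicator {k} (X x)) * expectation (\<lambda>x. F k (Y x))" .
    moreover have "expectation (\<lambda>x. indicator {x \<in> space M. X x = k} x * F (X x) (Y x))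
        = expectation (\<lambda>x. indicator {k} (X x) * F k (Y x))"
      by (intro Bochner_Integration.integral_cong) (auto simp: indicator_def)
    moreover have "expectation (\<lambda>x. indicator {k} (X x) :: real) = pt_prob M X k"
    proof -
      have "expectation (\<lambda>x. indicator {k} (X x) :: real)
          = expectation (indicator {x \<in> space M. X x = k})"
        by (intro Bochner_Integration.integral_cong) (auto simp: indicator_def)
      also have "\<dots> = pt_prob M X k"
        unfolding pt_prob_def using X by (subst Bochner_Integration.integral_indicator) (auto intro!: arg_cong[where f = "measure M"])
      finally show ?thesis .
    qed
    ultimately show ?thesis by simp
  qed
  with expectation_fibres[OF X F(1)] show ?thesis by simp
qed

lemma pt_prob_sums_expectation:
  fixes f :: "nat \<Rightarrow> real"
  assumes X: "X \<in> measurable M (count_space UNIV)" and f: "integrable M (\<lambda>x. f (X x))"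
  shows "(\<lambda>k. pt_prob M X k * f k) sums expectation (\<lambda>x. f (X x))"
proof -
  have "expectation (\<lambda>x. indicator {x \<in> space M. X x = k} x * f (X x)) = pt_prob M X k * f k" for k
  proof -
    have "expectation (\<lambda>x. indicator {x \<in> space M. X x = k} x * f (X x))
        = expectation (\<lambda>x. indicator {x \<in> space M. X x = k} x * f k)"
      by (intro Bochner_Integration.integral_cong) (auto simp: indicator_def)
    also have "\<dots> = pt_prob M X k * f k"
      unfolding pt_prob_def using X by (simp add: Bochner_Integration.integral_indicator) 
    finally show ?thesis .
  qed
  with expectation_fibres[OF X f] show ?thesis by simp
qed

lemma pt_prob_nonneg: "pt_prob M X k \<ge> 0"
  by (simp add: pt_prob_def)

lemma pt_prob_sums:
  assumes X: "X \<in> measurable M (count_space UNIV)"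
  shows "pt_prob M X sums 1"
  using pt_prob_sums_expectation[OF X, of "\<lambda>_. 1"] by (simp add: prob_space)

lemma one_minus_dtv_shift:
  assumes X: "X \<in> measurable M (count_space UNIV)"
  shows "1 - dtv_nat (pt_prob M X) (pt_prob M (\<lambda>x. X x + 1))
    = (\<Sum>k. min (pt_prob M X k) (pt_prob M X (Suc k)))"
  by (rule dtv_nat_overlap[OF pt_prob_nonneg pt_prob_sums[OF X]]) (simp_all add: pt_prob_def)

lemma indep_var_sum_nat:
  fixes \<zeta> :: "'i \<Rightarrow> 'a \<Rightarrow> nat"
  assumes I: "finite I" "i \<notin> I" and indep: "indep_vars (\<lambda>_. count_space UNIV) \<zeta> (insert i I)"
  shows "indep_var (count_space UNIV) (\<zeta> i) (count_space UNIV) (\<lambda>x. \<Sum>j\<in>I. \<zeta> j x)"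
proof -
  have "indep_var
    (count_space UNIV) ((\<lambda>f. f i) \<circ> (\<lambda>\<omega>. restrict (\<lambda>i. \<zeta> i \<omega>) {i}))
    (count_space UNIV) ((\<lambda>f. \<Sum>i\<in>I. f i) \<circ> (\<lambda>\<omega>. restrict (\<lambda>i. \<zeta> i \<omega>) I))"
    using I by (intro indep_var_compose[OF indep_var_restrict[OF indep]]) auto
  also have "((\<lambda>f. f i) \<circ> (\<lambda>\<omega>. restrict (\<lambda>i. \<zeta> i \<omega>) {i})) = \<zeta> i"
    by auto
  also have "((\<lambda>f. \<Sum>i\<in>I. f i) \<circ> (\<lambda>\<omega>. restrict (\<lambda>i. \<zeta> i \<omega>) I)) = (\<lambda>\<omega>. \<Sum>i\<in>I. \<zeta> i \<omega>)"
    by (auto cong: rev_conj_cong)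
  finally show ?thesis .
qed

text \<open>Induction on \<open>I\<close> with \<open>m\<close> the number of flips already
  extracted. Conditioning on the new summand \<open>\<zeta> j\<close> leaves a sum to which the
  mixture bound applies: the remainder keeps \<open>m\<close> flips, and the paired part gains one.
  These are the two terms of \<open>smooth_int_insert\<close>.\<close>

lemma smoothing_le_smooth_int:
  fixes \<zeta> :: "'i \<Rightarrow> 'a \<Rightarrow> nat" and f :: "nat \<Rightarrow> real"
  assumes "finite I" "indep_vars (\<lambda>_. count_space UNIV) \<zeta> I"
    and "\<And>j. j \<in> I \<Longrightarrow> 0 \<le> d j"
    and "\<And>j. j \<in> I \<Longrightarrow> d j \<le> (\<Sum>k. min (pt_prob M (\<zeta> j) k) (pt_prob M (\<zeta> j) (Suc k)))"
    and "\<And>n. 0 \<le> f n" "\<And>n. f n \<le> C"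
  shows "\<bar>expectation (\<lambda>x. (avg ^^ m) f (Suc (\<Sum>j\<in>I. \<zeta> j x)) - (avg ^^ m) f (\<Sum>j\<in>I. \<zeta> j x))\<bar>
           \<le> C * smooth_int d I m"
  using assms
proof (induction I arbitrary: m f rule: finite_induct)
  case empty
  then show ?case
    using avg_pow_diff_le[of f C m 0] by (simp add: smooth_int_empty prob_space)
next
  case (insert j I)
  define W where "W x = (\<Sum>i\<in>I. \<zeta> i x)" for x
  have ind: "indep_var (count_space UNIV) (\<zeta> j) (count_space UNIV) W"
    unfolding W_def[abs_def] using insert by (intro indep_var_sum_nat) auto
  have indI: "indep_vars (\<lambda>_. count_space UNIV) \<zeta> I"
    using insert.prems(1) by (rule indep_vars_subset) auto
  note \<zeta> = indep_var_rv1[OF ind] and W = indep_var_rv2[OF ind]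
  define \<Phi> where "\<Phi> m n = (avg ^^ m) f (Suc n) - (avg ^^ m) f n" for m n
  have \<Phi>_bdd: "\<bar>\<Phi> m n\<bar> \<le> C" for m n
    unfolding \<Phi>_def
    using avg_pow_bounds[where f = f and C = C and m = m and n = n, OF insert.prems(4,5)]
      avg_pow_bounds[where f = f and C = C and m = m and n = "Suc n", OF insert.prems(4,5)]
    by linarith
  define \<phi> where "\<phi> m k = expectation (\<lambda>x. \<Phi> m (k + W x))" for m k
  have \<Phi>_int: "integrable M (\<lambda>x. \<Phi> m (k + W x))" for m k
    using \<Phi>_bdd by (intro integrable_bounded_comp[OF W]) auto
  \<comment> \<open>Fixing \<open>\<zeta> j = k\<close> only translates the test function, hence the
    induction is general in \<open>f\<close>.\<close>
  have IH: "\<bar>\<phi> m k\<bar> \<le> C * smooth_int d I m" for m k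
    using insert.IH[OF indI, of "\<lambda>n. f (k + n)" m] insert.prems
    unfolding \<phi>_def \<Phi>_def W_def avg_pow_shift by simp
  have "\<zeta>W \<in> measurable M (count_space UNIV)" if "\<zeta>W = (\<lambda>x. \<zeta> j x + W x)" for \<zeta>W
    using \<zeta> W unfolding that by measurable
  then have "integrable M (\<lambda>x. \<Phi> m (\<zeta> j x + W x))"
    using \<Phi>_bdd by (intro integrable_bounded_comp[of "\<lambda>x. \<zeta> j x + W x"]) auto
  from expectation_indep_fibres[OF ind, where F = "\<lambda>k n. \<Phi> m (k + n)", OF this \<Phi>_int]
  have eq: "expectation (\<lambda>x. \<Phi> m (\<zeta> j x + W x)) = (\<Sum>k. pt_prob M (\<zeta> j) k * \<phi> m k)"
    unfolding \<phi>_def by (simp add: sums_iff)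
  \<comment> \<open>Averaging over a neighbouring pair is one more application of
    \<open>avg\<close>, so the induction hypothesis at \<open>Suc m\<close> covers it.\<close>
  have half: "(\<phi> m k + \<phi> m (Suc k)) / 2 = \<phi> (Suc m) k" for k
  proof -
    have "\<phi> (Suc m) k = expectation (\<lambda>x. (\<Phi> m (k + W x) + \<Phi> m (Suc k + W x)) / 2)"
      unfolding \<phi>_def by (intro Bochner_Integration.integral_cong) (auto simp: \<Phi>_def avg_def field_simps)
    then show ?thesis using \<Phi>_int[of m k] \<Phi>_int[of m "Suc k"] by (simp add: \<phi>_def)
  qed
  have "\<bar>\<phi> m k + \<phi> m (Suc k)\<bar> / 2 \<le> C * smooth_int d I (Suc m)" for k
    using IH[of "Suc m" k] unfolding half[symmetric] by simp
  then have "\<bar>\<Sum>k. pt_prob M (\<zeta> j) k * \<phi> m k\<bar>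
      \<le> (1 - d j) * (C * smooth_int d I m) + d j * (C * smooth_int d I (Suc m))"
    using insert.prems IH by (intro overlap_mixture_bound pt_prob_nonneg pt_prob_sums \<zeta>) auto
  also have "\<dots> = C * smooth_int d (insert j I) m"
    unfolding smooth_int_insert[OF insert.hyps(1,2)] by (simp add: algebra_simps)
  finally show ?case
    using insert.hyps unfolding eq[symmetric] \<Phi>_def W_def by simp
qed

lemma smoothing:
  fixes \<zeta> :: "'i \<Rightarrow> 'a \<Rightarrow> nat" and f :: "nat \<Rightarrow> real"
  assumes I: "finite I" "indep_vars (\<lambda>_. count_space UNIV) \<zeta> I"
    and d: "\<And>j. j \<in> I \<Longrightarrow> d j = min (1 / 2) (1 - dtv_nat (pt_prob M (\<zeta> j)) (pt_prob M (\<lambda>x. \<zeta> j x + 1)))"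
    and f: "\<And>n. 0 \<le> f n" "\<And>n. f n \<le> C"
  shows "\<bar>expectation (\<lambda>x. f (Suc (\<Sum>j\<in>I. \<zeta> j x)) - f (\<Sum>j\<in>I. \<zeta> j x))\<bar>
           \<le> C * (sqrt (2 / pi) * (1 / 4 + sum d I) powr (- 1 / 2))"
    and "\<And>j. j \<in> I \<Longrightarrow> 0 \<le> d j"
proof -
  let ?u = "\<lambda>j. \<Sum>k. min (pt_prob M (\<zeta> j) k) (pt_prob M (\<zeta> j) (Suc k))"
  have d': "d j = min (1 / 2) (?u j)" "0 \<le> ?u j" if "j \<in> I" for j
  proof -
    have \<zeta>: "\<zeta> j \<in> measurable M (count_space UNIV)"
      using I(2) that by (auto simp: indep_vars_def)
    show "d j = min (1 / 2) (?u j)" unfolding d[OF that] one_minus_dtv_shift[OF \<zeta>] ..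
    show "0 \<le> ?u j"
      by (intro suminf_nonneg overlap_summable[OF pt_prob_nonneg pt_prob_sums[OF \<zeta>]])
         (simp add: pt_prob_nonneg)
  qed
  then show d0: "\<And>j. j \<in> I \<Longrightarrow> 0 \<le> d j" by simp
  have "\<bar>expectation (\<lambda>x. (avg ^^ 0) f (Suc (\<Sum>j\<in>I. \<zeta> j x)) - (avg ^^ 0) f (\<Sum>j\<in>I. \<zeta> j x))\<bar>
           \<le> C * smooth_int d I 0"
    using d' by (intro smoothing_le_smooth_int I d0 f) auto
  also have "\<dots> \<le> C * (sqrt (2 / pi) * (1 / 4 + sum d I) powr (- 1 / 2))"
    using f[of 0] d' by (intro mult_left_mono smooth_int_le I d0) auto
  finally show "\<bar>expectation (\<lambda>x. f (Suc (\<Sum>j\<in>I. \<zeta> j x)) - f (\<Sum>j\<in>I. \<zeta> j x))\<bar>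
           \<le> C * (sqrt (2 / pi) * (1 / 4 + sum d I) powr (- 1 / 2))"
    by simp
qed

end

section \<open>The Stein identity and its expansions\<close>

text \<open>The defect in detailed balance: it vanishes for all \<open>k\<close> if
  \<open>\<gamma>\<close> is negative binomial with parameter \<open>p\<close> and mean
  \<open>m\<close>, where \<open>q = 1 - p\<close>.\<close>

definition coeff :: "real \<Rightarrow> real \<Rightarrow> real \<Rightarrow> (nat \<Rightarrow> real) \<Rightarrow> nat \<Rightarrow> real" where
  "coeff p q m \<gamma> k = (p * m + q * real k) * \<gamma> k - real (k + 1) * \<gamma> (k + 1)"

text \<open>As the coefficients sum to 0, \<open>\<phi> 0\<close> may be subtracted from
  \<open>\<phi>\<close>, and \<open>\<bar>\<phi> k - \<phi> 0\<bar> \<le> k C\<close>. The term at 0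
  drops out, so the sum starts at 1.\<close>

lemma first_order_bound:
  fixes c \<phi> :: "nat \<Rightarrow> real"
  assumes c: "c sums 0" "summable (\<lambda>k. real k * \<bar>c k\<bar>)"
    and \<phi>: "\<And>k. \<bar>\<phi> (Suc k) - \<phi> k\<bar> \<le> C"
    and s: "(\<lambda>k. c k * \<phi> k) sums s"
  shows "\<bar>s\<bar> \<le> C * (\<Sum>k. real (Suc k) * \<bar>c (Suc k)\<bar>)"
proof -
  have step: "\<bar>\<phi> k - \<phi> 0\<bar> \<le> real k * C" for k
  proof (induction k)
    case (Suc k)
    then show ?case using \<phi>[of k] by (simp add: algebra_simps)
  qed simp
  have "(\<lambda>k. c k * \<phi> k - c k * \<phi> 0) sums (s - 0 * \<phi> 0)"
    by (intro sums_diff s sums_mult2 c)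
  then have s': "(\<lambda>k. c k * (\<phi> k - \<phi> 0)) sums s" by (simp add: right_diff_distrib)
  have le: "norm (c k * (\<phi> k - \<phi> 0)) \<le> C * (real k * \<bar>c k\<bar>)" for k
    using mult_left_mono[OF step[of k], of "\<bar>c k\<bar>"] by (simp add: abs_mult mult_ac)
  have "\<bar>s\<bar> \<le> (\<Sum>k. C * (real k * \<bar>c k\<bar>))"
    using norm_suminf_le[OF le summable_mult[OF c(2)]] sums_unique[OF s'] by simp
  also have "\<dots> = C * (\<Sum>k. real k * \<bar>c k\<bar>)" by (rule suminf_mult[OF c(2)])
  also have "(\<Sum>k. real k * \<bar>c k\<bar>) = (\<Sum>k. real (Suc k) * \<bar>c (Suc k)\<bar>)"
    using suminf_split_head[OF c(2)] by simp
  finally show ?thesis .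
qed

text \<open>Subtracting the line through the first two values of \<open>\<phi>\<close> leaves a
  remainder of at most \<open>D\<close> times \<open>k choose 2\<close>. It vanishes at 0 and 1,
  hence the shift by 2.\<close>

lemma second_order_bound:
  fixes c \<phi> :: "nat \<Rightarrow> real"
  assumes c: "c sums 0" "(\<lambda>k. real k * c k) sums b" "summable (\<lambda>k. real (k * (k - 1)) / 2 * \<bar>c k\<bar>)"
    and \<phi>: "\<And>k. \<bar>(\<phi> (Suc (Suc k)) - \<phi> (Suc k)) - (\<phi> (Suc k) - \<phi> k)\<bar> \<le> D"
    and s: "(\<lambda>k. c k * \<phi> k) sums s"
  shows "\<bar>s - (\<phi> 1 - \<phi> 0) * b\<bar> \<le> D * (\<Sum>n. real ((n + 2) * (n + 1)) / 2 * \<bar>c (n + 2)\<bar>)"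
proof -
  define R where "R k = \<phi> k - \<phi> 0 - real k * (\<phi> 1 - \<phi> 0)" for k
  have slope: "\<bar>(\<phi> (Suc k) - \<phi> k) - (\<phi> 1 - \<phi> 0)\<bar> \<le> real k * D" for k
  proof (induction k)
    case (Suc k)
    then show ?case using \<phi>[of k] by (simp add: algebra_simps)
  qed simp
  have R: "\<bar>R k\<bar> \<le> real (k * (k - 1)) / 2 * D" for k
  proof (induction k)
    case (Suc k)
    have "R (Suc k) = R k + ((\<phi> (Suc k) - \<phi> k) - (\<phi> 1 - \<phi> 0))"
      by (simp add: R_def algebra_simps)
    then have "\<bar>R (Suc k)\<bar> \<le> real (k * (k - 1)) / 2 * D + real k * D"
      using Suc slope[of k] by linarith
    also have "\<dots> = real (Suc k * (Suc k - 1)) / 2 * D"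
      by (cases k) (auto simp: field_simps)
    finally show ?case .
  qed (simp add: R_def)
  have "(\<lambda>k. c k * \<phi> k - c k * \<phi> 0 - real k * c k * (\<phi> 1 - \<phi> 0)) sums (s - 0 * \<phi> 0 - b * (\<phi> 1 - \<phi> 0))"
    by (intro sums_diff s sums_mult2 c)
  moreover have "c k * \<phi> k - c k * \<phi> 0 - real k * c k * (\<phi> 1 - \<phi> 0) = c k * R k" for k
    by (simp add: R_def algebra_simps)
  ultimately have s': "(\<lambda>k. c k * R k) sums (s - (\<phi> 1 - \<phi> 0) * b)" by (simp add: mult.commute)
  have le: "norm (c k * R k) \<le> D * (real (k * (k - 1)) / 2 * \<bar>c k\<bar>)" for k
    using mult_left_mono[OF R[of k], of "\<bar>c k\<bar>"] by (simp add: abs_mult mult_ac)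
  have "\<bar>s - (\<phi> 1 - \<phi> 0) * b\<bar> \<le> (\<Sum>k. D * (real (k * (k - 1)) / 2 * \<bar>c k\<bar>))"
    using norm_suminf_le[OF le summable_mult[OF c(3)]] sums_unique[OF s'] by simp
  also have "\<dots> = D * (\<Sum>k. real (k * (k - 1)) / 2 * \<bar>c k\<bar>)" by (rule suminf_mult[OF c(3)])
  also have "(\<Sum>k. real (k * (k - 1)) / 2 * \<bar>c k\<bar>) = (\<Sum>n. real ((n + 2) * (n + 1)) / 2 * \<bar>c (n + 2)\<bar>)"
    using suminf_split_initial_segment[OF c(3), of 2] by (simp add: numeral_2_eq_2)
  finally show ?thesis .
qed

section \<open>Moments of the Stein coefficients\<close>

context prob_space
begin

lemma integrable_mult_bounded:
  fixes f :: "'a \<Rightarrow> real" and g :: "nat \<Rightarrow> real"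
  assumes f: "integrable M f" and Z: "Z \<in> measurable M (count_space UNIV)" and g: "\<And>n. \<bar>g n\<bar> \<le> K"
  shows "integrable M (\<lambda>x. f x * g (Z x))"
proof (rule Bochner_Integration.integrable_bound)
  show "integrable M (\<lambda>x. K * f x)" using f by simp
  have "(\<lambda>x. g (Z x)) \<in> borel_measurable M"
    by (rule measurable_compose[OF Z]) simp
  then show "(\<lambda>x. f x * g (Z x)) \<in> borel_measurable M"
    using f by (intro borel_measurable_times) auto
  have "\<bar>f x\<bar> * \<bar>g (Z x)\<bar> \<le> \<bar>K\<bar> * \<bar>f x\<bar>" for x
    using g[of "Z x"] mult_right_mono[of "\<bar>g (Z x)\<bar>" "\<bar>K\<bar>" "\<bar>f x\<bar>"] by (simp add: mult.commute)
  then show "AE x in M. norm (f x * g (Z x)) \<le> norm (K * f x)"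
    by (intro AE_I2) (simp add: abs_mult)
qed

text \<open>Both expectations are expanded over the values of \<open>X\<close>. In the second the
  term at 0 vanishes, so a shift by one brings both series to the argument
  \<open>Y + k + 1\<close>.\<close>

lemma coeff_sums:
  assumes ind: "indep_var (count_space UNIV) X (count_space UNIV) Y"
    and X: "integrable M (\<lambda>x. real (X x))"
    and g: "\<And>n. \<bar>g n\<bar> \<le> K"
  shows "(\<lambda>k. coeff p q (expectation (\<lambda>x. real (X x))) (pt_prob M X) k * expectation (\<lambda>x. g (Suc (Y x + k))))
     sums (expectation (\<lambda>x. (p * expectation (\<lambda>x. real (X x)) + q * real (X x)) * g (Suc (X x + Y x)))
            - expectation (\<lambda>x. real (X x) * g (X x + Y x)))"
proof -
  let ?m = "expectation (\<lambda>x. real (X x))"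
  note Xm = indep_var_rv1[OF ind] and Ym = indep_var_rv2[OF ind]
  have XY: "(\<lambda>x. X x + Y x) \<in> measurable M (count_space UNIV)"
    using Xm Ym by measurable
  have gY: "integrable M (\<lambda>x. g (k + Y x))" for k
    using g by (intro integrable_bounded_comp[OF Ym]) auto
  have "(\<lambda>k. pt_prob M X k * expectation (\<lambda>x. (p * ?m + q * real k) * g (Suc k + Y x)))
      sums expectation (\<lambda>x. (p * ?m + q * real (X x)) * g (Suc (X x) + Y x))"
  proof (rule expectation_indep_fibres[OF ind, where F = "\<lambda>k n. (p * ?m + q * real k) * g (Suc k + n)"])
    show "integrable M (\<lambda>x. (p * ?m + q * real (X x)) * g (Suc (X x) + Y x))"
      using integrable_mult_bounded[of "\<lambda>x. p * ?m + q * real (X x)", OF _ XY, of "\<lambda>n. g (Suc n)" K] X g by simp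
  qed (use gY in \<open>intro integrable_mult_right\<close>)
  moreover have "(\<lambda>k. pt_prob M X (Suc k) * expectation (\<lambda>x. real (Suc k) * g (Suc k + Y x)))
      sums expectation (\<lambda>x. real (X x) * g (X x + Y x))"
  proof -
    have "(\<lambda>k. pt_prob M X k * expectation (\<lambda>x. real k * g (k + Y x)))
      sums expectation (\<lambda>x. real (X x) * g (X x + Y x))"
    proof (rule expectation_indep_fibres[OF ind, where F = "\<lambda>k n. real k * g (k + n)"])
      show "integrable M (\<lambda>x. real (X x) * g (X x + Y x))"
        using integrable_mult_bounded[OF X XY, of g K] g by simp
    qed (use gY in \<open>intro integrable_mult_right\<close>)
    then show ?thesis by (subst sums_Suc_iff) simp
  qed
  ultimately have "(\<lambda>k. pt_prob M X k * expectation (\<lambda>x. (p * ?m + q * real k) * g (Suc k + Y x))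
        - pt_prob M X (Suc k) * expectation (\<lambda>x. real (Suc k) * g (Suc k + Y x)))
      sums (expectation (\<lambda>x. (p * ?m + q * real (X x)) * g (Suc (X x) + Y x)) - expectation (\<lambda>x. real (X x) * g (X x + Y x)))"
    by (rule sums_diff)
  moreover have "pt_prob M X k * expectation (\<lambda>x. (p * ?m + q * real k) * g (Suc k + Y x))
        - pt_prob M X (Suc k) * expectation (\<lambda>x. real (Suc k) * g (Suc k + Y x))
      = coeff p q ?m (pt_prob M X) k * expectation (\<lambda>x. g (Suc (Y x + k)))" for k
  proof -
    have "expectation (\<lambda>x. g (Suc (k + Y x))) = expectation (\<lambda>x. g (Suc (Y x + k)))"
      by (simp add: add.commute)
    then show ?thesis by (simp add: coeff_def left_diff_distrib del: of_nat_Suc)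
  qed
  ultimately show ?thesis by simp
qed

lemma integrable_power_nat_le:
  fixes X :: "'a \<Rightarrow> nat"
  assumes X: "X \<in> measurable M (count_space UNIV)" and int: "integrable M (\<lambda>x. real (X x) ^ n)" and "m \<le> n"
  shows "integrable M (\<lambda>x. real (X x) ^ m)"
proof (rule Bochner_Integration.integrable_bound[OF Bochner_Integration.integrable_add[OF int integrable_const[of 1]]])
  show "(\<lambda>x. real (X x) ^ m) \<in> borel_measurable M"
    by (rule measurable_compose[OF X]) simp
  have "real k ^ m \<le> real k ^ n + 1" for k :: nat
    using \<open>m \<le> n\<close> by (cases "k = 0") (auto intro: order_trans[OF power_increasing] simp: power_0_left)
  then show "AE x in M. norm (real (X x) ^ m) \<le> norm (real (X x) ^ n + 1)"
    by (intro AE_I2) simp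
qed

text \<open>Shifting the index in the subtracted part turns \<open>f k\<close> into
  \<open>f (X - 1)\<close>. The truncated subtraction is harmless because of the factor
  \<open>X\<close>. Below, \<open>f\<close> is 1, \<open>k\<close> and
  \<open>k (k - 1) / 2\<close>.\<close>

lemma coeff_moment_sums:
  fixes f :: "nat \<Rightarrow> real"
  assumes Xm: "X \<in> measurable M (count_space UNIV)"
    and int: "integrable M (\<lambda>x. f (X x))" "integrable M (\<lambda>x. real (X x) * f (X x))"
      "integrable M (\<lambda>x. real (X x) * f (X x - 1))"
  shows "(\<lambda>k. f k * coeff p q m (pt_prob M X) k) sums
    (p * m * expectation (\<lambda>x. f (X x)) + q * expectation (\<lambda>x. real (X x) * f (X x))
      - expectation (\<lambda>x. real (X x) * f (X x - 1)))" (is ?sum)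
    and "\<lbrakk>0 \<le> p; 0 \<le> q; 0 \<le> m; \<And>k. 0 \<le> f k\<rbrakk> \<Longrightarrow> summable (\<lambda>k. f k * \<bar>coeff p q m (pt_prob M X) k\<bar>)"
proof -
  have 1: "(\<lambda>k. p * m * (pt_prob M X k * f k) + q * (pt_prob M X k * (real k * f k))) sums
     (p * m * expectation (\<lambda>x. f (X x)) + q * expectation (\<lambda>x. real (X x) * f (X x)))"
    by (intro sums_add sums_mult pt_prob_sums_expectation Xm int)
  have "(\<lambda>k. pt_prob M X k * (real k * f (k - 1))) sums expectation (\<lambda>x. real (X x) * f (X x - 1))"
    by (intro pt_prob_sums_expectation Xm int)
  then have 2: "(\<lambda>k. pt_prob M X (Suc k) * (real (Suc k) * f k)) sums expectation (\<lambda>x. real (X x) * f (X x - 1))"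
    using sums_Suc_iff[of "\<lambda>k. pt_prob M X k * (real k * f (k - 1))"] by simp
  show ?sum
    using sums_diff[OF 1 2] by (simp add: coeff_def algebra_simps)
  assume nn: "0 \<le> p" "0 \<le> q" "0 \<le> m" "\<And>k. 0 \<le> f k"
  show "summable (\<lambda>k. f k * \<bar>coeff p q m (pt_prob M X) k\<bar>)"
  proof (rule summable_comparison_test'[OF sums_summable[OF sums_add[OF 1 2]], of 0])
    fix k
    have "\<bar>coeff p q m (pt_prob M X) k\<bar> \<le> (p * m + q * real k) * pt_prob M X k + real (k + 1) * pt_prob M X (k + 1)"
      unfolding coeff_def using nn pt_prob_nonneg
      by (intro order_trans[OF abs_triangle_ineq4]) (simp add: abs_mult)
    then have "f k * \<bar>coeff p q m (pt_prob M X) k\<bar>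
      \<le> f k * ((p * m + q * real k) * pt_prob M X k + real (k + 1) * pt_prob M X (k + 1))"
      using nn by (intro mult_left_mono) auto
    then show "norm (f k * \<bar>coeff p q m (pt_prob M X) k\<bar>)
      \<le> p * m * (pt_prob M X k * f k) + q * (pt_prob M X k * (real k * f k)) + pt_prob M X (Suc k) * (real (Suc k) * f k)"
      using nn by (simp add: abs_mult algebra_simps)
  qed
qed

lemma coeff_facts:
  fixes X :: "'a \<Rightarrow> nat"
  defines "m \<equiv> expectation (\<lambda>x. real (X x))"
  assumes Xm: "X \<in> measurable M (count_space UNIV)" and X3: "integrable M (\<lambda>x. real (X x) ^ 3)"
    and pq: "0 \<le> p" "0 \<le> q" "p + q = 1"
  shows "coeff p q m (pt_prob M X) sums 0"
    and "(\<lambda>k. real k * coeff p q m (pt_prob M X) k) sums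
       (p * m\<^sup>2 + q * expectation (\<lambda>x. (real (X x))\<^sup>2) - expectation (\<lambda>x. real (X x) * (real (X x) - 1)))"
    and "summable (\<lambda>k. real k * \<bar>coeff p q m (pt_prob M X) k\<bar>)"
    and "summable (\<lambda>k. real (k * (k - 1)) / 2 * \<bar>coeff p q m (pt_prob M X) k\<bar>)"
proof -
  have int: "integrable M (\<lambda>x. real (X x) ^ n)" if "n \<le> 3" for n
    by (rule integrable_power_nat_le[OF Xm X3 that])
  have int1: "integrable M (\<lambda>x. real (X x))" and int2: "integrable M (\<lambda>x. (real (X x))\<^sup>2)"
    using int[of 1] int[of 2] by simp_all
  have m0: "0 \<le> m" unfolding m_def by simp
  have *: "real k * real (k - 1) = real k ^ 2 - real k" for k :: nat
    by (cases k) (auto simp: power2_eq_square algebra_simps)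
  \<comment> \<open>Truncated subtraction obscures the cubic identity, so the values below 2 are
    checked separately.\<close>
  have **: "real k * (real ((k - 1) * (k - 1 - 1)) / 2) = (real k ^ 3 - 3 * real k ^ 2 + 2 * real k) / 2" for k :: nat
  proof (cases "k < 2")
    case True
    then show ?thesis by (cases k) auto
  next
    case False
    then obtain j where "k = Suc (Suc j)" by (metis add_2_eq_Suc le_Suc_ex not_less)
    then show ?thesis by (simp add: power2_eq_square power3_eq_cube algebra_simps)
  qed
  have ***: "real (k * (k - 1)) / 2 = (real k ^ 2 - real k) / 2" for k :: nat using *[of k] by simp
  have "(\<lambda>k. 1 * coeff p q m (pt_prob M X) k) sums (p * m * expectation (\<lambda>x. 1)
      + q * expectation (\<lambda>x. real (X x) * 1) - expectation (\<lambda>x. real (X x) * 1))"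
    using int1 by (intro coeff_moment_sums(1)[OF Xm, where f = "\<lambda>_. 1"]) auto
  moreover have "p * m + q * m - m = 0" using pq(3) by (metis cancel_comm_monoid_add_class.diff_cancel distrib_right mult_1)
  ultimately show "coeff p q m (pt_prob M X) sums 0"
    by (simp add: prob_space m_def)
  have i1: "integrable M (\<lambda>x. real (X x) * real (X x))" "integrable M (\<lambda>x. real (X x) * real (X x - 1))"
    using int1 int2 unfolding * by (auto simp: power2_eq_square)
  show "(\<lambda>k. real k * coeff p q m (pt_prob M X) k) sums
       (p * m\<^sup>2 + q * expectation (\<lambda>x. (real (X x))\<^sup>2) - expectation (\<lambda>x. real (X x) * (real (X x) - 1)))"
    using coeff_moment_sums(1)[OF Xm, where f = real, OF int1 i1, of p q m] unfolding *
    by (simp add: power2_eq_square m_def[symmetric] algebra_simps)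
  show "summable (\<lambda>k. real k * \<bar>coeff p q m (pt_prob M X) k\<bar>)"
    using i1 int1 pq m0 by (intro coeff_moment_sums(2)[OF Xm]) auto
  show "summable (\<lambda>k. real (k * (k - 1)) / 2 * \<bar>coeff p q m (pt_prob M X) k\<bar>)"
  proof (rule coeff_moment_sums(2)[OF Xm])
    show "integrable M (\<lambda>x. real (X x * (X x - 1)) / 2)"
      unfolding *** using int1 int2 by simp
    have "integrable M (\<lambda>x. (real (X x) ^ 3 - real (X x) ^ 2) / 2)"
      using X3 int2 by simp
    moreover have "real (X x) * (real (X x * (X x - 1)) / 2) = (real (X x) ^ 3 - real (X x) ^ 2) / 2" for x
      unfolding *** by (simp add: power2_eq_square power3_eq_cube algebra_simps)
    ultimately show "integrable M (\<lambda>x. real (X x) * (real (X x * (X x - 1)) / 2))" by simp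
    show "integrable M (\<lambda>x. real (X x) * (real ((X x - 1) * (X x - 1 - 1)) / 2))"
      unfolding ** using X3 int1 int2 by simp
  qed (use pq m0 in auto)
qed


lemma indep_var_expectation_mult_nat:
  assumes ind: "indep_var (count_space UNIV) X (count_space UNIV) Y"
    and "integrable M (\<lambda>x. real (X x))" "integrable M (\<lambda>x. real (Y x))"
  shows "expectation (\<lambda>x. real (X x) * real (Y x)) = expectation (\<lambda>x. real (X x)) * expectation (\<lambda>x. real (Y x))"
    and "integrable M (\<lambda>x. real (X x) * real (Y x))"
proof -
  have "indep_var borel (real \<circ> X) borel (real \<circ> Y)"
    by (rule indep_var_compose[OF ind]) auto
  then have "indep_var borel (\<lambda>x. real (X x)) borel (\<lambda>x. real (Y x))" by (simp add: comp_def)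
  from indep_var_lebesgue_integral[OF this assms(2,3)] indep_var_integrable[OF this assms(2,3)]
  show "expectation (\<lambda>x. real (X x) * real (Y x)) = expectation (\<lambda>x. real (X x)) * expectation (\<lambda>x. real (Y x))"
    "integrable M (\<lambda>x. real (X x) * real (Y x))" by auto
qed

end

section \<open>First- and second-order bounds for the Stein expectation\<close>

text \<open>Only two properties of the Stein solution are retained: it is bounded, and its downward
  steps at positive arguments lie in \<open>[0, C]\<close>. The same setting then serves every
  \<open>z\<close>.\<close>

locale stein_setting = prob_space M for M :: "'a measure" +
  fixes \<zeta> :: "nat \<Rightarrow> 'a \<Rightarrow> nat" and J :: "nat set" and p q r C K :: real and g :: "nat \<Rightarrow> real"
    and d :: "nat \<Rightarrow> real"
  assumes J: "finite J"
    and indep: "indep_vars (\<lambda>_. count_space UNIV) \<zeta> J"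
    and third: "\<And>i. i \<in> J \<Longrightarrow> integrable M (\<lambda>x. real (\<zeta> i x) ^ 3)"
    and p: "0 < p" "p < 1" and q: "q = 1 - p"
    and g_bdd: "\<And>n. \<bar>g n\<bar> \<le> K"
    and g_diff: "\<And>n. 0 \<le> g (Suc n) - g (Suc (Suc n))" "\<And>n. g (Suc n) - g (Suc (Suc n)) \<le> C"
    and d: "\<And>j. d j = min (1 / 2) (1 - dtv_nat (pt_prob M (\<zeta> j)) (pt_prob M (\<lambda>x. \<zeta> j x + 1)))"
begin

definition V :: "'a \<Rightarrow> nat" where "V x = (\<Sum>i\<in>J. \<zeta> i x)"
definition Vc :: "nat \<Rightarrow> 'a \<Rightarrow> nat" where "Vc i x = (\<Sum>j\<in>J - {i}. \<zeta> j x)"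
definition mean :: "nat \<Rightarrow> real" where "mean i = expectation (\<lambda>x. real (\<zeta> i x))"
definition sqmean :: "nat \<Rightarrow> real" where "sqmean i = expectation (\<lambda>x. (real (\<zeta> i x))\<^sup>2)"
definition facmean :: "nat \<Rightarrow> real" where "facmean i = expectation (\<lambda>x. real (\<zeta> i x) * (real (\<zeta> i x) - 1))"
definition cf :: "nat \<Rightarrow> nat \<Rightarrow> real" where "cf i = coeff p q (mean i) (pt_prob M (\<zeta> i))"
definition \<phi> :: "nat \<Rightarrow> nat \<Rightarrow> real" where "\<phi> i k = expectation (\<lambda>x. g (Suc (Vc i x + k)))"
definition stein_part :: "nat \<Rightarrow> real" where
  "stein_part i = expectation (\<lambda>x. (p * mean i + q * real (\<zeta> i x)) * g (Suc (V x)))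
     - expectation (\<lambda>x. real (\<zeta> i x) * g (V x))"

lemma indep_i:
  assumes "i \<in> J"
  shows "indep_var (count_space UNIV) (\<zeta> i) (count_space UNIV) (Vc i)"
proof -
  have "insert i (J - {i}) = J" using assms by auto
  then show ?thesis
    unfolding Vc_def[abs_def] using J indep by (intro indep_var_sum_nat) auto
qed

lemma V_split:
  assumes "i \<in> J"
  shows "V x = \<zeta> i x + Vc i x"
  unfolding V_def Vc_def using J assms by (rule sum.remove)

lemma \<zeta>_meas: "i \<in> J \<Longrightarrow> \<zeta> i \<in> measurable M (count_space UNIV)"
  using indep by (auto simp: indep_vars_def)

lemma Vc_meas: "i \<in> J \<Longrightarrow> Vc i \<in> measurable M (count_space UNIV)"
  using indep_var_rv2[OF indep_i] .

lemma \<zeta>_int: "i \<in> J \<Longrightarrow> integrable M (\<lambda>x. real (\<zeta> i x))" "i \<in> J \<Longrightarrow> integrable M (\<lambda>x. (real (\<zeta> i x))\<^sup>2)"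
  using integrable_power_nat_le[OF \<zeta>_meas third, of i 1] integrable_power_nat_le[OF \<zeta>_meas third, of i 2] by auto

lemma V_meas: "V \<in> measurable M (count_space UNIV)"
proof (cases "J = {}")
  case True
  have "V x = 0" for x unfolding V_def by (simp add: True)
  then show ?thesis by (simp cong: measurable_cong)
next
  case False
  then obtain i where "i \<in> J" by auto
  then have "(\<lambda>x. \<zeta> i x + Vc i x) \<in> measurable M (count_space UNIV)"
    using \<zeta>_meas Vc_meas by measurable
  then show ?thesis using V_split[OF \<open>i \<in> J\<close>] by (simp add: fun_eq_iff cong: measurable_cong)
qed

lemma V_int: "integrable M (\<lambda>x. real (V x))"
  unfolding V_def by (simp add: \<zeta>_int)

lemma expectation_V: "expectation (\<lambda>x. real (V x)) = (\<Sum>i\<in>J. mean i)"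
  unfolding V_def mean_def by (simp add: \<zeta>_int)

lemma Vc_int: "i \<in> J \<Longrightarrow> integrable M (\<lambda>x. real (Vc i x))"
  unfolding Vc_def by (auto intro!: Bochner_Integration.integrable_sum \<zeta>_int)

lemma expectation_Vc:
  assumes "i \<in> J"
  shows "expectation (\<lambda>x. real (Vc i x)) = expectation (\<lambda>x. real (V x)) - mean i"
  unfolding V_split[OF assms] mean_def using assms by (simp add: \<zeta>_int Vc_int)

lemma term_sums:
  assumes "i \<in> J"
  shows "(\<lambda>k. cf i k * \<phi> i k) sums stein_part i"
  unfolding cf_def \<phi>_def stein_part_def mean_def V_split[OF assms]
  by (rule coeff_sums[OF indep_i[OF assms] \<zeta>_int(1)[OF assms] g_bdd])

text \<open>Equality of the means gives \<open>q r = p * (\<Sum>i\<in>J. mean i)\<close>, so the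
  operator distributes over the summands.\<close>

lemma stein_sum:
  assumes mean: "r * q / p = expectation (\<lambda>x. real (V x))"
  shows "expectation (\<lambda>x. stein_op r p g (V x)) = (\<Sum>i\<in>J. stein_part i)"
proof -
  have rq: "q * r = p * (\<Sum>i\<in>J. mean i)"
    using mean p unfolding expectation_V by (simp add: field_simps)
  have eq: "stein_op r p g (V x)
      = (\<Sum>i\<in>J. (p * mean i + q * real (\<zeta> i x)) * g (Suc (V x)) - real (\<zeta> i x) * g (V x))" for x
  proof -
    have "stein_op r p g (V x) = (q * r + q * real (V x)) * g (Suc (V x)) - real (V x) * g (V x)"
      by (simp add: stein_op_def q algebra_simps)
    also have "\<dots> = (\<Sum>i\<in>J. (p * mean i + q * real (\<zeta> i x))) * g (Suc (V x)) - (\<Sum>i\<in>J. real (\<zeta> i x)) * g (V x)"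
      unfolding rq by (simp add: V_def sum.distrib sum_distrib_left)
    finally show ?thesis by (simp add: sum_distrib_right sum_subtractf)
  qed
  have i1: "integrable M (\<lambda>x. (p * mean i + q * real (\<zeta> i x)) * g (Suc (V x)))" if "i \<in> J" for i
    using integrable_mult_bounded[OF _ V_meas, of "\<lambda>x. p * mean i + q * real (\<zeta> i x)" "\<lambda>n. g (Suc n)" K]
      g_bdd \<zeta>_int(1)[OF that] by simp
  have i2: "integrable M (\<lambda>x. real (\<zeta> i x) * g (V x))" if "i \<in> J" for i
    by (rule integrable_mult_bounded[OF \<zeta>_int(1)[OF that] V_meas g_bdd])
  show ?thesis
    unfolding eq stein_part_def
    by (subst Bochner_Integration.integral_sum)
       (auto intro!: sum.cong Bochner_Integration.integral_diff Bochner_Integration.integrable_diff i1 i2)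
qed

lemma \<phi>_int: "i \<in> J \<Longrightarrow> integrable M (\<lambda>x. g (Suc (Vc i x + k)))"
  using g_bdd by (intro integrable_bounded_comp[OF Vc_meas, of _ "\<lambda>n. g (Suc (n + k))"]) auto

lemma \<phi>_diff:
  assumes "i \<in> J"
  shows "\<bar>\<phi> i (Suc k) - \<phi> i k\<bar> \<le> C"
proof -
  have "\<phi> i k - \<phi> i (Suc k) = expectation (\<lambda>x. g (Suc (Vc i x + k)) - g (Suc (Suc (Vc i x + k))))"
    unfolding \<phi>_def using \<phi>_int[OF assms, of k] \<phi>_int[OF assms, of "Suc k"] by simp
  moreover have "0 \<le> \<dots>" using g_diff(1) by (intro Bochner_Integration.integral_nonneg) auto
  moreover have "expectation (\<lambda>x. g (Suc (Vc i x + k)) - g (Suc (Suc (Vc i x + k)))) \<le> expectation (\<lambda>_. C)"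
    using g_diff(2) \<phi>_int[OF assms, of k] \<phi>_int[OF assms, of "Suc k"] by (intro integral_mono) auto
  ultimately show ?thesis by (simp add: prob_space)
qed

lemmas cf_facts = coeff_facts[OF \<zeta>_meas third, of _ p q, folded mean_def sqmean_def facmean_def cf_def]

lemma first_bound:
  assumes "r * q / p = expectation (\<lambda>x. real (V x))"
  shows "\<bar>expectation (\<lambda>x. stein_op r p g (V x))\<bar>
    \<le> C * (\<Sum>i\<in>J. \<Sum>k. real (Suc k) * \<bar>cf i (Suc k)\<bar>)"
proof -
  have "\<bar>stein_part i\<bar> \<le> C * (\<Sum>k. real (Suc k) * \<bar>cf i (Suc k)\<bar>)" if "i \<in> J" for i
    using p q by (intro first_order_bound[OF _ _ \<phi>_diff[OF that] term_sums[OF that]] cf_facts that) auto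
  then show ?thesis
    unfolding stein_sum[OF assms] sum_distrib_left by (intro order_trans[OF sum_abs] sum_mono)
qed

lemma d_nonneg: "i \<in> J \<Longrightarrow> 0 \<le> d i"
  by (rule smoothing(2)[OF J indep, of d "\<lambda>_. 0" 0]) (simp_all add: d)

text \<open>Removing one summand costs at most the largest \<open>d j\<close>; subtracting that
  maximum gives one constant valid for all \<open>V i\<close>.\<close>

definition smooth_const :: real where
  "smooth_const = sqrt (2 / pi) * (1 / 4 + (\<Sum>j\<in>J. d j) - Max (d ` J)) powr (- 1 / 2)"

lemma smooth_const_ge:
  assumes "i \<in> J"
  shows "sqrt (2 / pi) * (1 / 4 + (\<Sum>j\<in>J - {i}. d j)) powr (- 1 / 2) \<le> smooth_const"
proof -
  have "Max (d ` J) \<in> d ` J" using J assms by (intro Max_in) auto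
  then obtain k where k: "k \<in> J" "Max (d ` J) = d k" by auto
  \<comment> \<open>The maximum is attained at \<open>k\<close>, so the base is at least
    \<open>1 / 4\<close>; positivity is needed because the power is decreasing.\<close>
  have "(\<Sum>j\<in>J. d j) = d k + (\<Sum>j\<in>J - {k}. d j)" using J k by (simp add: sum.remove)
  moreover have "0 \<le> (\<Sum>j\<in>J - {k}. d j)" by (intro sum_nonneg d_nonneg) auto
  moreover have "(\<Sum>j\<in>J. d j) = d i + (\<Sum>j\<in>J - {i}. d j)" using J assms by (simp add: sum.remove)
  moreover have "d i \<le> Max (d ` J)" using J assms by simp
  ultimately show ?thesis
    unfolding smooth_const_def using k by (intro mult_left_mono powr_mono2') auto
qed

text \<open>The second difference of \<open>\<phi> i\<close> is, up to sign, the expected first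
  difference of the steps of \<open>g\<close>. These lie in \<open>[0, C]\<close>, so smoothing over
  \<open>J - {i}\<close> applies.\<close>

lemma \<phi>_second_diff:
  assumes "i \<in> J"
  shows "\<bar>(\<phi> i (Suc (Suc k)) - \<phi> i (Suc k)) - (\<phi> i (Suc k) - \<phi> i k)\<bar> \<le> C * smooth_const"
proof -
  let ?f = "\<lambda>n. g (Suc (n + k)) - g (Suc (Suc (n + k)))"
  have C: "0 \<le> C" using g_diff(1)[of 0] g_diff(2)[of 0] by linarith
  have "\<bar>expectation (\<lambda>x. ?f (Suc (\<Sum>j\<in>J - {i}. \<zeta> j x)) - ?f (\<Sum>j\<in>J - {i}. \<zeta> j x))\<bar>
      \<le> C * (sqrt (2 / pi) * (1 / 4 + sum d (J - {i})) powr (- 1 / 2))"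
    using J indep_vars_subset[OF indep, of "J - {i}"] d g_diff
    by (intro smoothing(1)) auto
  also have "\<dots> \<le> C * smooth_const"
    by (intro mult_left_mono smooth_const_ge assms C)
  also have "expectation (\<lambda>x. ?f (Suc (\<Sum>j\<in>J - {i}. \<zeta> j x)) - ?f (\<Sum>j\<in>J - {i}. \<zeta> j x))
      = - ((\<phi> i (Suc (Suc k)) - \<phi> i (Suc k)) - (\<phi> i (Suc k) - \<phi> i k))"
    unfolding Vc_def[symmetric] \<phi>_def
    using \<phi>_int[OF assms, of k] \<phi>_int[OF assms, of "Suc k"] \<phi>_int[OF assms, of "Suc (Suc k)"] by simp
  finally show ?thesis by simp
qed

text \<open>Each summand is \<open>mean i - p\<close> times the variance of
  \<open>\<zeta> i\<close>. By independence the total is \<open>E V - p Var V\<close>, and matching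
  both moments makes this \<open>r q / p - p * (r q / p\<^sup>2) = 0\<close>.\<close>

lemma sum_second_moment_zero:
  assumes mean: "r * q / p = expectation (\<lambda>x. real (V x))"
    and var: "r * q / p\<^sup>2 = variance (\<lambda>x. real (V x))"
  shows "(\<Sum>i\<in>J. p * (mean i)\<^sup>2 + q * sqmean i - facmean i) = 0"
proof -
  let ?EV = "expectation (\<lambda>x. real (V x))"
  have prod: "expectation (\<lambda>x. real (\<zeta> i x) * real (V x)) = sqmean i + mean i * (?EV - mean i)"
    "integrable M (\<lambda>x. real (\<zeta> i x) * real (V x))" if "i \<in> J" for i
  proof -
    note ind = indep_var_expectation_mult_nat[OF indep_i[OF that] \<zeta>_int(1)[OF that] Vc_int[OF that]]
    have eq: "real (\<zeta> i x) * real (V x) = (real (\<zeta> i x))\<^sup>2 + real (\<zeta> i x) * real (Vc i x)" for x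
      unfolding V_split[OF that] by (simp add: power2_eq_square algebra_simps)
    show "integrable M (\<lambda>x. real (\<zeta> i x) * real (V x))"
      unfolding eq using ind(2) \<zeta>_int(2)[OF that] by simp
    have "expectation (\<lambda>x. real (\<zeta> i x) * real (V x)) = sqmean i + mean i * expectation (\<lambda>x. real (Vc i x))"
      unfolding eq using ind \<zeta>_int(2)[OF that] by (simp add: sqmean_def mean_def)
    then show "expectation (\<lambda>x. real (\<zeta> i x) * real (V x)) = sqmean i + mean i * (?EV - mean i)"
      unfolding expectation_Vc[OF that] .
  qed
  \<comment> \<open>Only one factor is expanded, so independence is needed just between
    \<open>\<zeta> i\<close> and the rest of the sum.\<close>
  have V2: "(real (V x))\<^sup>2 = (\<Sum>i\<in>J. real (\<zeta> i x) * real (V x))" for x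
    by (simp add: power2_eq_square sum_distrib_right[symmetric]) (simp add: V_def)
  have "integrable M (\<lambda>x. (real (V x))\<^sup>2)" unfolding V2 using prod(2) by simp
  then have "variance (\<lambda>x. real (V x)) = expectation (\<lambda>x. (real (V x))\<^sup>2) - ?EV\<^sup>2"
    by (intro variance_eq V_int)
  also have "expectation (\<lambda>x. (real (V x))\<^sup>2) = (\<Sum>i\<in>J. sqmean i + mean i * (?EV - mean i))"
    unfolding V2 using prod by simp
  also have "\<dots> = (\<Sum>i\<in>J. sqmean i - (mean i)\<^sup>2) + ?EV\<^sup>2"
    by (simp add: sum.distrib sum_subtractf right_diff_distrib power2_eq_square
        sum_distrib_right[symmetric] expectation_V[symmetric])
  finally have var_eq: "variance (\<lambda>x. real (V x)) = (\<Sum>i\<in>J. sqmean i - (mean i)\<^sup>2)" by simp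
  have "facmean i = sqmean i - mean i" if "i \<in> J" for i
    unfolding facmean_def sqmean_def mean_def using \<zeta>_int[OF that]
    by (simp add: right_diff_distrib power2_eq_square)
  then have "(\<Sum>i\<in>J. p * (mean i)\<^sup>2 + q * sqmean i - facmean i)
      = (\<Sum>i\<in>J. mean i - p * (sqmean i - (mean i)\<^sup>2))"
    by (intro sum.cong) (auto simp: q algebra_simps)
  also have "\<dots> = ?EV - p * variance (\<lambda>x. real (V x))"
    unfolding var_eq unfolding expectation_V sum_distrib_left by (simp only: sum_subtractf)
  also have "\<dots> = 0"
    unfolding var[symmetric] unfolding mean[symmetric] using p by (simp add: power2_eq_square)
  finally show ?thesis .
qed

text \<open>The first-order terms cancel over \<open>i\<close> only with a common slope.
  Conditioning on \<open>\<zeta> i = k\<close> gives the slope of \<open>\<phi> i\<close> at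
  \<open>k\<close>, which differs from the slope at 0 by at most \<open>k\<close> second
  differences; averaging over \<open>k\<close> produces \<open>mean i\<close>.\<close>

lemma slope_mean:
  assumes "i \<in> J"
  shows "\<bar>expectation (\<lambda>x. g (Suc (Suc (V x))) - g (Suc (V x))) - (\<phi> i 1 - \<phi> i 0)\<bar> \<le> C * smooth_const * mean i"
proof -
  let ?\<psi> = "\<lambda>k. \<phi> i (Suc k) - \<phi> i k"
  let ?\<gamma> = "pt_prob M (\<zeta> i)"
  have slope: "\<bar>?\<psi> k - ?\<psi> 0\<bar> \<le> real k * (C * smooth_const)" for k
  proof (induction k)
    case (Suc k)
    then show ?case using \<phi>_second_diff[OF assms, of k] by (simp add: algebra_simps)
  qed simp
  have "(\<lambda>k. ?\<gamma> k * expectation (\<lambda>x. g (Suc (Suc (k + Vc i x))) - g (Suc (k + Vc i x))))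
      sums expectation (\<lambda>x. g (Suc (Suc (\<zeta> i x + Vc i x))) - g (Suc (\<zeta> i x + Vc i x)))"
  proof (rule expectation_indep_fibres[OF indep_i[OF assms], where F = "\<lambda>k n. g (Suc (Suc (k + n))) - g (Suc (k + n))"])
    show "integrable M (\<lambda>x. g (Suc (Suc (k + Vc i x))) - g (Suc (k + Vc i x)))" for k
      using \<phi>_int[OF assms, of k] \<phi>_int[OF assms, of "Suc k"] by (simp add: add.commute)
    have "integrable M (\<lambda>x. g (Suc (V x)))" "integrable M (\<lambda>x. g (Suc (Suc (V x))))"
      using integrable_bounded_comp[OF V_meas, of "\<lambda>n. g (Suc n)" K]
        integrable_bounded_comp[OF V_meas, of "\<lambda>n. g (Suc (Suc n))" K] g_bdd by auto
    then show "integrable M (\<lambda>x. g (Suc (Suc (\<zeta> i x + Vc i x))) - g (Suc (\<zeta> i x + Vc i x)))"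
      unfolding V_split[OF assms] by simp
  qed
  moreover have "expectation (\<lambda>x. g (Suc (Suc (k + Vc i x))) - g (Suc (k + Vc i x))) = ?\<psi> k" for k
    unfolding \<phi>_def using \<phi>_int[OF assms, of k] \<phi>_int[OF assms, of "Suc k"] by (simp add: add.commute)
  ultimately have "(\<lambda>k. ?\<gamma> k * ?\<psi> k) sums expectation (\<lambda>x. g (Suc (Suc (V x))) - g (Suc (V x)))"
    unfolding V_split[OF assms] by simp
  from sums_diff[OF this sums_mult2[OF pt_prob_sums[OF \<zeta>_meas[OF assms]], of "?\<psi> 0"]]
  have s: "(\<lambda>k. ?\<gamma> k * (?\<psi> k - ?\<psi> 0)) sums (expectation (\<lambda>x. g (Suc (Suc (V x))) - g (Suc (V x))) - ?\<psi> 0)"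
    by (simp add: right_diff_distrib)
  have m: "(\<lambda>k. ?\<gamma> k * real k) sums mean i"
    unfolding mean_def by (rule pt_prob_sums_expectation[OF \<zeta>_meas \<zeta>_int(1)]) (rule assms)+
  have le: "norm (?\<gamma> k * (?\<psi> k - ?\<psi> 0)) \<le> C * smooth_const * (?\<gamma> k * real k)" for k
    using mult_left_mono[OF slope[of k] pt_prob_nonneg[of "\<zeta> i" k]] pt_prob_nonneg[of "\<zeta> i" k]
    by (simp add: abs_mult mult_ac)
  have "\<bar>expectation (\<lambda>x. g (Suc (Suc (V x))) - g (Suc (V x))) - ?\<psi> 0\<bar>
      \<le> (\<Sum>k. C * smooth_const * (?\<gamma> k * real k))"
    using norm_suminf_le[OF le summable_mult[OF sums_summable[OF m]]] sums_unique[OF s] by simp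
  also have "\<dots> = C * smooth_const * mean i"
    using sums_unique[OF sums_mult[OF m]] by simp
  finally show ?thesis by simp
qed

lemma second_bound:
  assumes mean: "r * q / p = expectation (\<lambda>x. real (V x))"
    and var: "r * q / p\<^sup>2 = variance (\<lambda>x. real (V x))"
  shows "\<bar>expectation (\<lambda>x. stein_op r p g (V x))\<bar>
    \<le> C * (smooth_const * ((\<Sum>i\<in>J. mean i * \<bar>p * (mean i)\<^sup>2 + q * sqmean i - facmean i\<bar>)
        + (\<Sum>i\<in>J. \<Sum>n. real ((n + 2) * (n + 1)) / 2 * \<bar>cf i (n + 2)\<bar>)))"
proof -
  define b where "b i = p * (mean i)\<^sup>2 + q * sqmean i - facmean i" for i
  define \<psi> where "\<psi> = expectation (\<lambda>x. g (Suc (Suc (V x))) - g (Suc (V x)))"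
  define T where "T i = (\<Sum>n. real ((n + 2) * (n + 1)) / 2 * \<bar>cf i (n + 2)\<bar>)" for i
  have main: "\<bar>stein_part i - (\<phi> i 1 - \<phi> i 0) * b i\<bar> \<le> C * smooth_const * T i" if "i \<in> J" for i
    unfolding T_def b_def using p q
    by (intro second_order_bound[OF _ _ _ \<phi>_second_diff[OF that] term_sums[OF that]] cf_facts that) auto
  have each: "\<bar>stein_part i - \<psi> * b i\<bar> \<le> C * smooth_const * (mean i * \<bar>b i\<bar> + T i)" if "i \<in> J" for i
  proof -
    have "\<bar>\<psi> - (\<phi> i 1 - \<phi> i 0)\<bar> * \<bar>b i\<bar> \<le> C * smooth_const * mean i * \<bar>b i\<bar>"
      unfolding \<psi>_def by (intro mult_right_mono slope_mean that) simp
    moreover have "stein_part i - \<psi> * b i = (stein_part i - (\<phi> i 1 - \<phi> i 0) * b i) - (\<psi> - (\<phi> i 1 - \<phi> i 0)) * b i"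
      by (simp add: algebra_simps)
    then have "\<bar>stein_part i - \<psi> * b i\<bar>
        \<le> \<bar>stein_part i - (\<phi> i 1 - \<phi> i 0) * b i\<bar> + \<bar>\<psi> - (\<phi> i 1 - \<phi> i 0)\<bar> * \<bar>b i\<bar>"
      unfolding abs_mult[symmetric] by (simp only: abs_triangle_ineq4)
    ultimately show ?thesis using main[OF that] by (simp add: algebra_simps)
  qed
  \<comment> \<open>The common slope \<open>\<psi>\<close> multiplies a sum that is 0, so
    subtracting it term by term is free.\<close>
  have "(\<Sum>i\<in>J. stein_part i) = (\<Sum>i\<in>J. stein_part i - \<psi> * b i)"
    using sum_second_moment_zero[OF mean var] by (simp add: sum_subtractf sum_distrib_left[symmetric] b_def)
  then have "\<bar>expectation (\<lambda>x. stein_op r p g (V x))\<bar> \<le> (\<Sum>i\<in>J. C * smooth_const * (mean i * \<bar>b i\<bar> + T i))"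
    unfolding stein_sum[OF mean] using each by (simp only:) (intro order_trans[OF sum_abs] sum_mono)
  then show ?thesis
    unfolding b_def T_def by (simp only: sum.distrib sum_distrib_left[symmetric] mult.assoc)
qed

end

section \<open>Comparison of constants and conclusion\<close>

text \<open>Nonnegativity of \<open>u\<close> is read off from the bound itself, so enlarging the
  constant requires no separate argument about the sums in \<open>u\<close>.\<close>

lemma abs_le_scale_mono:
  fixes c c' x u :: real
  assumes "\<bar>x\<bar> \<le> c * u" "0 < c" "c \<le> c'"
  shows "\<bar>x\<bar> \<le> c' * u"
proof -
  have "0 \<le> c * u" using assms(1) by linarith
  then have "0 \<le> u" using assms(2) by (simp add: zero_le_mult_iff)
  then show ?thesis using assms mult_right_mono[of c c' u] by linarith
qed

theorem theorem3p3:
  fixes M :: "'a measure" and J :: "nat set" and \<zeta> :: "nat \<Rightarrow> 'a \<Rightarrow> nat"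
    and r p q :: real and V :: "'a \<Rightarrow> nat" and \<gamma> :: "nat \<Rightarrow> nat \<Rightarrow> real"
    and \<delta> Ez Ez2 Efac2 :: "nat \<Rightarrow> real" and EV VarV Ua Ub :: real and E \<theta> :: "real \<Rightarrow> real"
  assumes "prob_space M"
    and "finite J"
    and "prob_space.indep_vars M (\<lambda>_. count_space UNIV) \<zeta> J"
    and "\<And>i. i \<in> J \<Longrightarrow> integrable M (\<lambda>x. real (\<zeta> i x) ^ 3)"
    and "r > 1" and "0 < p" and "p < 1"
  assumes q_def: "q = 1 - p"
    and "V = (\<lambda>x. \<Sum>i\<in>J. \<zeta> i x)"
    and "\<gamma> = (\<lambda>i k. pt_prob M (\<zeta> i) k)"
    and "\<delta> = (\<lambda>j. min (1 / 2)
               (1 - dtv_nat (pt_prob M (\<zeta> j)) (pt_prob M (\<lambda>x. \<zeta> j x + 1))))"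
    and "EV = integral\<^sup>L M (\<lambda>x. real (V x))"
    and "VarV = integral\<^sup>L M (\<lambda>x. (real (V x) - integral\<^sup>L M (\<lambda>x. real (V x))) ^ 2)"
    and "Ez = (\<lambda>i. integral\<^sup>L M (\<lambda>x. real (\<zeta> i x)))"
    and "Ez2 = (\<lambda>i. integral\<^sup>L M (\<lambda>x. real (\<zeta> i x) ^ 2))"
    and "Efac2 = (\<lambda>i. integral\<^sup>L M (\<lambda>x. real (\<zeta> i x) * (real (\<zeta> i x) - 1)))"
    and "Ua = (\<Sum>i\<in>J. \<Sum>k. real (Suc k) *
               \<bar>(p * Ez i + q * real (Suc k)) * \<gamma> i (Suc k) - real (Suc k + 1) * \<gamma> i (Suc k + 1)\<bar>)"
    and "Ub = sqrt (2 / pi) * (1 / 4 + (\<Sum>j\<in>J. \<delta> j) - Max (\<delta> ` J)) powr (- 1 / 2) *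
               ((\<Sum>i\<in>J. Ez i * \<bar>p * (Ez i)\<^sup>2 + q * Ez2 i - Efac2 i\<bar>)
                + (\<Sum>i\<in>J. \<Sum>n. real ((n + 2) * (n + 1)) / 2 *
                    \<bar>(p * Ez i + q * real (n + 2)) * \<gamma> i (n + 2) - real (n + 3) * \<gamma> i (n + 3)\<bar>))"
    and "E = (\<lambda>z. integral\<^sup>L M (\<lambda>x. stein_op r p (stein_g r p z) (V x)))"
    and "\<theta> = (\<lambda>z. (r + 1) / z * ((1 + 1 / q) * p powr (- (r + 2)) - p powr (- 2)))"
  shows "(r * q / p = EV \<longrightarrow>
            (\<forall>z\<ge>0. \<bar>E z\<bar> \<le> (2 * p powr (- (r + 1)) - 1 / p) * Ua) \<and>
            (\<forall>z>1. \<bar>E z\<bar> \<le> \<theta> z * Ua))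
       \<and> (r * q / p = EV \<and> r * q / p\<^sup>2 = VarV \<longrightarrow>
            (\<forall>z\<ge>0. \<bar>E z\<bar> \<le> (2 * p powr (- (r + 1)) - 1 / p) * Ub) \<and>
            (\<forall>z>1. \<bar>E z\<bar> \<le> \<theta> z * Ub))"
proof -
  note defs = assms(9-20)
  interpret prob_space M by fact
  interpret nb: neg_binomial r p q
    using assms(5-8) by unfold_locales auto
  have p: "0 < p" "p < 1" and q: "0 < q" "q < 1" using assms(6-8) by auto
  let ?P = "p powr (- (r + 1))"
  have P: "0 < ?P" "1 / p \<le> ?P"
    using p \<open>r > 1\<close> powr_mono'[of "- (r + 1)" "- 1" p] by (auto simp: powr_minus_divide)
  \<comment> \<open>The constant actually obtained; both constants of the statement dominate
    it.\<close>
  define c where "c z = ?P / max 1 z" for z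
  have c_pos: "0 < c z" for z using P by (simp add: c_def)
  have c1: "c z \<le> 2 * ?P - 1 / p" for z
  proof -
    have "c z \<le> ?P / 1" unfolding c_def using P by (intro divide_left_mono) auto
    then show ?thesis using P by simp
  qed
  have c2: "c z \<le> \<theta> z" if "z > 1" for z
  proof -
    let ?Q = "p powr (- (r + 2))"
    have Q: "?P \<le> ?Q" "p powr (- 2) \<le> ?Q" using p \<open>r > 1\<close> by (auto intro!: powr_mono')
    \<comment> \<open>The part \<open>?Q / q\<close> absorbs the subtracted
      \<open>p powr - 2\<close>, so the bracket is at least \<open>?Q\<close>; the factor
      \<open>r + 1\<close> only enlarges it.\<close>
    have "?Q \<le> ?Q / q" using q by (simp add: pos_le_divide_eq mult_left_le)
    then have le: "?P \<le> (1 + 1 / q) * ?Q - p powr (- 2)" using Q by (simp add: algebra_simps)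
    have "1 * ((1 + 1 / q) * ?Q - p powr (- 2)) \<le> (r + 1) * ((1 + 1 / q) * ?Q - p powr (- 2))"
      using le P(1) \<open>r > 1\<close> by (intro mult_right_mono) linarith+
    from order_trans[OF le this[unfolded mult_1]] have "?P / z \<le> (r + 1) * ((1 + 1 / q) * ?Q - p powr (- 2)) / z"
      using that by (intro divide_right_mono) auto
    then show ?thesis using that by (simp add: c_def assms(20))
  qed
  have bounds: "(r * q / p = EV \<longrightarrow> \<bar>E z\<bar> \<le> c z * Ua) \<and>
      (r * q / p = EV \<and> r * q / p\<^sup>2 = VarV \<longrightarrow> \<bar>E z\<bar> \<le> c z * Ub)" if z: "z \<ge> 0" for z
  proof -
    obtain K where K: "\<And>n. \<bar>stein_g r p z n\<bar> \<le> K" using nb.stein_g_bounded[OF z] by blast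
    have up: "stein_g r p z (Suc n) - stein_g r p z (Suc (Suc n)) \<le> c z" for n
      using nb.stein_g_diff_bounds(2)[OF z, of "Suc n"] by (simp add: c_def pos_le_divide_eq mult.commute)
    interpret S: stein_setting M \<zeta> J p q r "c z" K "stein_g r p z" \<delta>
      using assms(2-4) p q_def K up nb.stein_g_diff_bounds(1)[OF z]
      by unfold_locales (auto simp: assms(11))
    have V: "S.V = V" unfolding S.V_def[abs_def] assms(9) ..
    have Ua: "Ua = (\<Sum>i\<in>J. \<Sum>k. real (Suc k) * \<bar>S.cf i (Suc k)\<bar>)"
      unfolding assms(10,14,17) S.cf_def coeff_def S.mean_def ..
    have Ub: "Ub = S.smooth_const * ((\<Sum>i\<in>J. S.mean i * \<bar>p * (S.mean i)\<^sup>2 + q * S.sqmean i - S.facmean i\<bar>)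
        + (\<Sum>i\<in>J. \<Sum>n. real ((n + 2) * (n + 1)) / 2 * \<bar>S.cf i (n + 2)\<bar>))"
    proof -
      have "n + 2 + 1 = n + 3" for n :: nat by simp
      then show ?thesis
        unfolding assms(10,14,15,16,18) S.cf_def coeff_def S.mean_def S.sqmean_def S.facmean_def S.smooth_const_def
        by (simp only:)
    qed
    show ?thesis
      using S.first_bound S.second_bound unfolding Ua Ub V assms(12,13,19) by blast
  qed
  show ?thesis
    using bounds abs_le_scale_mono[OF _ c_pos c1] abs_le_scale_mono[OF _ c_pos c2] by (auto 4 4)
qed

end
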